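(* Let $w$ be any $A_{\infty,\mathcal R}$ weight in $\mathbb{R}^n$ and let $a:\mathcal R\to(0,\infty)$ be a functional with $a\in D_{p,\mathcal R}(w)$ (a condition defined for $0<p<\infty$). Let $f$ be a locally integrable function such that $$\frac1{|R|}\int_{R} |f - P_{R}f|\,dx\le a(R)\qquad \text{for every } R\in \mathcal R.$$ Then there exists a dimensional constant $c>0$ such that for every $R\in \mathcal R$, $$\big\| f-P_Rf \big\|_{L^{p,\infty}\left( R, \frac{w\,dx}{w(R)}\right)} \leq c\, p\, [w]_{A_{\infty,\mathcal R}}\,\|a\|_{D_{p,\mathcal R}(w)} \, a(R).$$
   Context: $\mathcal R$ is the family of rectangles in $\mathbb{R}^n$, i.e. $n$-fold products of bounded intervals of $\mathbb R$. A weight is a nonnegative locally integrable function $w$ on $\mathbb{R}^n$, and $w(E)=\int_E w\,dx$; $|E|$ is Lebesgue measure. Dyadic subrectangles of $R\in\mathcal R$: those obtained from $R$ by successively dividing rectangles into $2^n$ congruent subrectangles by bisecting every side (generation $0$ being $R$ itself). Condition $D_{p,\mathcal R}(w)$, for $0<p<\infty$: there is a constant $c$ such that for every $R\in\mathcal R$ and every family $\{R_i\}_i$ of pairwise disjoint dyadic subrectangles of $R$, $\big(\sum_i a(R_i)^p\frac{w(R_i)}{w(R)}\big)^{1/p}\le c\,a(R)$. The best possible (smallest) such $c$ is denoted $\|a\|_{D_{p,\mathcal R}(w)}$, and one writes $a\in D_{p,\mathcal R}(w)$. For $1<r<\infty$, $[w]_{A_{r,\mathcal R}}:=\sup_{R\in\mathcal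 R}\big(\frac1{|R|}\int_R w\,dx\big)\big(\frac1{|R|}\int_R w^{-\frac1{r-1}}\,dx\big)^{r-1}$, $A_{r,\mathcal R}$ is the class of weights for which this is finite, $A_{\infty,\mathcal R}=\bigcup_{r>1}A_{r,\mathcal R}$, and $[w]_{A_{\infty,\mathcal R}}:=\sup_{R\in\mathcal R}\frac1{w(R)}\int_R M_s(w\chi_R)\,dx$, where $M_s g(x)=\sup_{\mathcal R\ni R\ni x}\frac1{|R|}\int_R|g|$ is the strong maximal function. Normalized weak (quasi)norm, for $0<p<\infty$: $\|g\|_{L^{p,\infty}(R,\frac{w\,dx}{w(R)})}=\sup_{t>0}t\,\big(\frac{1}{w(R)}w(\{x\in R:|g(x)|>t\})\big)^{1/p}$. The polynomial $P_Rf$: fix an integer $m\ge0$ and let $\mathcal P_m$ be the space of polynomials in $n$ variables of degree at most $m$, with inner product $\langle f,g\rangle_R=\frac1{|R|}\int_R fg\,dx$. If $\{\phi_\alpha\}$ is an orthonormal basis of $\mathcal P_m$ for this inner product, then $P_Rf=\sum_\alpha\big(\frac1{|R|}\int_R f\phi_\alpha\,dx\big)\phi_\alpha$. (For $m=0$, $P_Rf$ is the average of $f$ over $R$.)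
   Formalization: The constant c depends on n, the degree m and a lower bound p0>0 for p (purely dimensional for p≥1), since a dimensional c for all 0<p<∞ fails as p→0: n=1, m=0, w=1, a=1, f=sign, R=[-1,1] would give 1≤cp. *)

theory Defs
  imports "HOL-Analysis.Analysis" "HOL-Library.Disjoint_Sets"
begin

section \<open>Rectangles and their dyadic subrectangles\<close>

text \<open>
  The sides may be open, closed or half-open, but they are nondegenerate, so that every
  rectangle has positive and finite Lebesgue measure.
\<close>

definition rectangles :: "(real ^ 'n) set set" where
  "rectangles = {{x. \<forall>i. x $ i \<in> I i} | I.
     \<forall>i. is_interval (I i) \<and> bounded (I i) \<and> interior (I i) \<noteq> {}}"

definition midpt :: "(real ^ 'n) set \<Rightarrow> 'n \<Rightarrow> real" where
  "midpt R i = (Inf ((\<lambda>x. x $ i) ` R) + Sup ((\<lambda>x. x $ i) ` R)) / 2"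

text \<open>
  The \<open>2^n\<close> pieces obtained by bisecting every side; \<open>A\<close> is the set of coordinates in which
  the upper half is taken.  The midpoint of a side is assigned to the upper half, so the pieces
  partition \<open>R\<close>, and disjointness below is honest set-theoretic disjointness.
\<close>

definition dyadic_children :: "(real ^ 'n) set \<Rightarrow> (real ^ 'n) set set" where
  "dyadic_children R =
     {{x \<in> R. \<forall>i. if i \<in> A then midpt R i \<le> x $ i else x $ i < midpt R i} | A. True}"

inductive_set dyadic_subrectangles :: "(real ^ 'n) set \<Rightarrow> (real ^ 'n) set set"
  for R :: "(real ^ 'n) set" where
  self: "R \<in> dyadic_subrectangles R"
| bisect: "Q \<in> dyadic_subrectangles R \<Longrightarrow> Q' \<in> dyadic_children Q \<Longrightarrow> Q' \<in> dyadic_subrectangles R"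


section \<open>Locally integrable functions and weights\<close>

definition locally_integrable :: "(real ^ 'n \<Rightarrow> real) \<Rightarrow> bool" where
  "locally_integrable f \<longleftrightarrow> (\<forall>K. compact K \<longrightarrow> f absolutely_integrable_on K)"

definition weight :: "(real ^ 'n \<Rightarrow> real) \<Rightarrow> bool" where
  "weight w \<longleftrightarrow> locally_integrable w \<and> (\<forall>x. 0 \<le> w x)"

definition wmeas :: "(real ^ 'n \<Rightarrow> real) \<Rightarrow> (real ^ 'n) set \<Rightarrow> ennreal" where
  "wmeas w E = (\<integral>\<^sup>+x\<in>E. ennreal (w x) \<partial>lebesgue)"

text \<open>Power of an extended nonnegative number; only used for exponents \<open>s > 0\<close>.\<close>

definition epowr :: "ennreal \<Rightarrow> real \<Rightarrow> ennreal" where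
  "epowr x s = (if x = top then top else ennreal (enn2real x powr s))"

text \<open>
  The negative power \<open>w powr (-1/(r-1))\<close> is written as \<open>epowr (1/w) (1/(r-1))\<close>, so that it is
  infinite where \<open>w\<close> vanishes (the real-valued \<open>0 powr s\<close> would be \<open>0\<close>).
\<close>

definition A_const :: "real \<Rightarrow> (real ^ 'n \<Rightarrow> real) \<Rightarrow> ennreal" where
  "A_const r w = (SUP R\<in>rectangles.
     (wmeas w R / emeasure lebesgue R) *
     epowr ((\<integral>\<^sup>+x\<in>R. epowr (inverse (ennreal (w x))) (1 / (r - 1)) \<partial>lebesgue)
              / emeasure lebesgue R) (r - 1))"

definition A_class :: "real \<Rightarrow> (real ^ 'n \<Rightarrow> real) set" where
  "A_class r = {w. weight w \<and> A_const r w < top}"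

definition A_infty :: "(real ^ 'n \<Rightarrow> real) set" where
  "A_infty = (\<Union>r\<in>{1<..}. A_class r)"

definition strong_maximal :: "(real ^ 'n \<Rightarrow> real) \<Rightarrow> real ^ 'n \<Rightarrow> ennreal" where
  "strong_maximal g x = (SUP R\<in>{R \<in> rectangles. x \<in> R}.
     (\<integral>\<^sup>+y\<in>R. ennreal \<bar>g y\<bar> \<partial>lebesgue) / emeasure lebesgue R)"

definition A_infty_const :: "(real ^ 'n \<Rightarrow> real) \<Rightarrow> ennreal" where
  "A_infty_const w = (SUP R\<in>rectangles.
     (\<integral>\<^sup>+x\<in>R. strong_maximal (\<lambda>y. w y * indicator R y) x \<partial>lebesgue) / wmeas w R)"


section \<open>The condition \<open>D\<^sub>p\<close> and the normalized weak norm\<close>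

definition D_bound :: "real \<Rightarrow> (real ^ 'n \<Rightarrow> real) \<Rightarrow> ((real ^ 'n) set \<Rightarrow> real) \<Rightarrow> ennreal \<Rightarrow> bool" where
  "D_bound p w a c \<longleftrightarrow>
     (\<forall>R\<in>rectangles. \<forall>F. F \<subseteq> dyadic_subrectangles R \<and> disjoint F \<longrightarrow>
        epowr (\<Sum>\<^sub>\<infinity>Q\<in>F. ennreal (a Q powr p) * (wmeas w Q / wmeas w R)) (1 / p)
          \<le> c * ennreal (a R))"

definition D_class :: "real \<Rightarrow> (real ^ 'n \<Rightarrow> real) \<Rightarrow> ((real ^ 'n) set \<Rightarrow> real) set" where
  "D_class p w = {a. \<exists>c. c < top \<and> D_bound p w a c}"

definition D_norm :: "real \<Rightarrow> (real ^ 'n \<Rightarrow> real) \<Rightarrow> ((real ^ 'n) set \<Rightarrow> real) \<Rightarrow> ennreal" where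
  "D_norm p w a = Inf {c. D_bound p w a c}"

definition weak_norm ::
  "real \<Rightarrow> (real ^ 'n) set \<Rightarrow> (real ^ 'n \<Rightarrow> real) \<Rightarrow> (real ^ 'n \<Rightarrow> real) \<Rightarrow> ennreal" where
  "weak_norm p R w g = (SUP t\<in>{0<..}.
     ennreal t * epowr (wmeas w {x \<in> R. \<bar>g x\<bar> > t} / wmeas w R) (1 / p))"


section \<open>Averages and the polynomial projection\<close>

definition avg :: "(real ^ 'n) set \<Rightarrow> (real ^ 'n \<Rightarrow> real) \<Rightarrow> real" where
  "avg R g = (1 / measure lebesgue R) * (LINT x:R|lebesgue. g x)"

definition polys :: "nat \<Rightarrow> (real ^ 'n \<Rightarrow> real) set" where
  "polys m = {(\<lambda>x. \<Sum>k | (\<Sum>i\<in>UNIV. k i) \<le> m. c k * (\<Prod>i\<in>UNIV. (x $ i) ^ k i)) | c.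
     True}"

definition orthonormal_basis ::
  "nat \<Rightarrow> (real ^ 'n) set \<Rightarrow> (real ^ 'n \<Rightarrow> real) set \<Rightarrow> bool" where
  "orthonormal_basis m R B \<longleftrightarrow>
     finite B \<and> B \<subseteq> polys m \<and>
     (\<forall>\<phi>\<in>B. \<forall>\<psi>\<in>B. avg R (\<lambda>x. \<phi> x * \<psi> x) = (if \<phi> = \<psi> then 1 else 0)) \<and>
     (\<forall>q\<in>polys m. \<exists>c. q = (\<lambda>x. \<Sum>\<phi>\<in>B. c \<phi> * \<phi> x))"

text \<open>The result does not depend on which orthonormal basis is chosen.\<close>

definition proj ::
  "nat \<Rightarrow> (real ^ 'n) set \<Rightarrow> (real ^ 'n \<Rightarrow> real) \<Rightarrow> real ^ 'n \<Rightarrow> real" where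
  "proj m R f = (let B = (SOME B. orthonormal_basis m R B)
     in (\<lambda>x. \<Sum>\<phi>\<in>B. avg R (\<lambda>y. f y * \<phi> y) * \<phi> x))"

end

(*
  Fix R and stop repeatedly: below a stopped rectangle Q take the maximal dyadic Q' on which
  |f - P_Q f| has average above 2 a(Q).  They fill at most half of Q, and
  f - P_Q f = (f - P_Q' f) + P_Q' (f - P_Q f) with the last term O(a(Q)) on Q'.  Hence
  |f - P_R f| is bounded almost everywhere by a constant times the sum of a(Q) over the stopped
  rectangles Q containing the point.  No reverse Hoelder inequality is needed for the weight:
  each stopped Q has a portion of at least half its measure, disjoint from the other portions,
  on which the strong maximal function is at least w(Q)/|Q|.  So the w-measures of the successive
  generations below Q add up to at most 2 [w] w(Q), and w halves every O([w]) generations.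
  A good-lambda inequality between the levels t and (1 + 1/p) t, in which a(Q) > t / O(p [w])
  is controlled by D_p on a disjoint family, gives the weak bound, linear in p [w].
*)
theory Submission
  imports Defs "HOL-Computational_Algebra.Polynomial"
begin

section \<open>Stopping trees of sets\<close>

text \<open>D_p controls only disjoint families, whereas the stopped rectangles are nested, so D_p
  cannot be applied to the sum along a path as a whole. The good-lambda inequality meets this by
  using D_p only on maximal rectangles with a(Q) > \<epsilon> t. A point in none of them climbs from
  t to (1 + 1/p) t in steps of at most \<epsilon> t, hence stays in the tree for about 1/(\<epsilon>
  p) generations. With K = O([w]) generations to halve w, 3 K of them give a factor 1/8, so
  \<epsilon> is of order 1/(p K): this is the origin of the product p [w]. The ratio 1 + 1/p costs
  (1 + 1/p)^p \<le> 3 per iteration, which 1/8 beats for every p. The final constant contains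
  8^(1/p), the p-th root of a factor 8. Some lower bound on p is unavoidable: for m = 0, w = 1, a =
  1 and f the sign of one coordinate, the weak norm on a rectangle symmetric in that coordinate is 1
  for every p, while c p tends to 0 with p.\<close>

lemma emeasure_Union_le_family:
  assumes V: "countable V" "disjoint V" "V \<subseteq> sets M"
    and X: "\<And>Q. Q \<in> V \<Longrightarrow> X Q \<in> sets N" "\<And>Q. Q \<in> V \<Longrightarrow> X Q \<subseteq> Q"
    and le: "\<And>Q. Q \<in> V \<Longrightarrow> emeasure N (X Q) \<le> c * emeasure M Q"
  shows "emeasure N (\<Union>Q\<in>V. X Q) \<le> c * emeasure M (\<Union>V)"
proof -
  have dV: "disjoint_family_on (\<lambda>Q. Q) V"
    using V(2) unfolding disjoint_family_on_def disjoint_def by blast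
  then have dX: "disjoint_family_on X V"
    using X(2) unfolding disjoint_family_on_def by blast
  have "emeasure N (\<Union>Q\<in>V. X Q) = (\<integral>\<^sup>+Q. emeasure N (X Q) \<partial>count_space V)"
    by (rule emeasure_UN_countable) (use V X dX in auto)
  also have "\<dots> \<le> (\<integral>\<^sup>+Q. c * emeasure M Q \<partial>count_space V)"
    by (rule nn_integral_mono) (use le in auto)
  also have "\<dots> = c * (\<integral>\<^sup>+Q. emeasure M Q \<partial>count_space V)"
    by (rule nn_integral_cmult) auto
  also have "(\<integral>\<^sup>+Q. emeasure M Q \<partial>count_space V) = emeasure M (\<Union>Q\<in>V. Q)"
    by (rule emeasure_UN_countable[symmetric]) (use V dV in auto)
  finally show ?thesis by simp
qed

section \<open>Generations of a tree of sets and its maximal nodes\<close>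

primrec gen :: "('a set \<Rightarrow> 'a set set) \<Rightarrow> nat \<Rightarrow> 'a set \<Rightarrow> 'a set set" where
  "gen ch 0 Q = {Q}"
| "gen ch (Suc k) Q = (\<Union>Q'\<in>gen ch k Q. ch Q')"

lemma gen_add: "gen ch (j + k) Q = (\<Union>Q'\<in>gen ch j Q. gen ch k Q')"
  by (induction k) auto

text \<open>Instantiated twice: by bisection, and by the stopping rule. Children need not cover
  their parent, and \<open>D\<close> may contain more than the descendants of one root, so that
  estimates can be made at every node.\<close>

locale set_tree =
  fixes D :: "'a set set" and ch :: "'a set \<Rightarrow> 'a set set"
  assumes countable_nodes: "countable D"
    and children_nodes: "Q \<in> D \<Longrightarrow> ch Q \<subseteq> D"
    and children_disjoint: "Q \<in> D \<Longrightarrow> disjoint (ch Q)"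
    and children_subset: "Q \<in> D \<Longrightarrow> Q' \<in> ch Q \<Longrightarrow> Q' \<subseteq> Q"
begin

definition layer :: "nat \<Rightarrow> 'a set \<Rightarrow> 'a set" where
  "layer k Q = \<Union>(gen ch k Q)"

text \<open>The maximal nodes with property \<open>P\<close>, that is, its stopping family.
  \<open>P\<close> also receives the generation, because a set need not determine it and the partial
  sums in \<open>superlevel_eq\<close> depend on it.\<close>

definition first :: "'a set \<Rightarrow> (nat \<Rightarrow> 'a set \<Rightarrow> bool) \<Rightarrow> 'a set set" where
  "first R P = {Q. \<exists>j. Q \<in> gen ch j R \<and> P j Q \<and> (\<forall>i<j. \<forall>Q'\<in>gen ch i R. Q \<subseteq> Q' \<longrightarrow> \<not> P i Q')}"

lemma gen_nodes: "Q \<in> D \<Longrightarrow> gen ch k Q \<subseteq> D"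
proof (induction k)
  case (Suc k) then show ?case using children_nodes by fastforce
qed auto

lemma gen_subset: "Q \<in> D \<Longrightarrow> Q' \<in> gen ch k Q \<Longrightarrow> Q' \<subseteq> Q"
proof (induction k arbitrary: Q')
  case (Suc k)
  then obtain P where P: "P \<in> gen ch k Q" "Q' \<in> ch P" by auto
  then have "P \<in> D" using gen_nodes Suc.prems(1) by blast
  then show ?case using Suc.IH[OF Suc.prems(1) P(1)] children_subset P(2) by blast
qed auto

lemma gen_ancestor:
  assumes "i \<le> j" "Q' \<in> gen ch j R"
  shows "\<exists>Q\<in>gen ch i R. Q' \<in> gen ch (j - i) Q"
  using assms gen_add[of ch i "j - i" R] by auto

lemma gen_disjoint: "Q \<in> D \<Longrightarrow> disjoint (gen ch k Q)"
proof (induction k)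
  case (Suc k)
  show ?case
  proof (rule disjointI)
    fix A B assume A: "A \<in> gen ch (Suc k) Q" and B: "B \<in> gen ch (Suc k) Q" and "A \<noteq> B"
    obtain P where P: "P \<in> gen ch k Q" "A \<in> ch P" using A by auto
    obtain P' where P': "P' \<in> gen ch k Q" "B \<in> ch P'" using B by auto
    have D: "P \<in> D" "P' \<in> D" using gen_nodes Suc.prems P P' by blast+
    show "A \<inter> B = {}"
    proof (cases "P = P'")
      case True
      then show ?thesis using children_disjoint[OF D(1)] P P' \<open>A \<noteq> B\<close> by (auto simp: disjoint_def)
    next
      case False
      then have "P \<inter> P' = {}" using Suc.IH[OF Suc.prems] P P' by (auto simp: disjoint_def)
      then show ?thesis using children_subset D P P' by blast
    qed
  qed
qed auto

lemma gen_unique: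
  "Q \<in> D \<Longrightarrow> A \<in> gen ch k Q \<Longrightarrow> B \<in> gen ch k Q \<Longrightarrow> x \<in> A \<Longrightarrow> x \<in> B \<Longrightarrow> A = B"
  using gen_disjoint[of Q k] by (auto simp: disjoint_def)

lemma layer_0 [simp]: "layer 0 Q = Q"
  by (simp add: layer_def)

lemma layer_add: "layer (j + k) Q = (\<Union>Q'\<in>gen ch j Q. layer k Q')"
  by (auto simp: layer_def gen_add)

lemma layer_subset: "Q \<in> D \<Longrightarrow> layer k Q \<subseteq> Q"
  using gen_subset by (auto simp: layer_def)

lemma layer_antimono:
  assumes "Q \<in> D" "i \<le> j" shows "layer j Q \<subseteq> layer i Q"
proof -
  have "layer j Q = (\<Union>Q'\<in>gen ch i Q. layer (j - i) Q')" using layer_add[of i "j - i"] assms by simp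
  also have "\<dots> \<subseteq> layer i Q"
    using layer_subset gen_nodes[OF assms(1)] by (fastforce simp: layer_def[of i])
  finally show ?thesis .
qed

lemma first_nodes: "R \<in> D \<Longrightarrow> first R P \<subseteq> D"
proof
  fix Q assume "R \<in> D" "Q \<in> first R P"
  then obtain j where "Q \<in> gen ch j R" unfolding first_def by (elim CollectE exE conjE)
  then show "Q \<in> D" using gen_nodes[OF \<open>R \<in> D\<close>, of j] by (rule subsetD[rotated])
qed

text \<open>The ancestor of the deeper node in the generation of the shallower one meets that one,
  hence is that one. By the minimality in \<open>first\<close> this is possible only for equal
  generations, and then for equal nodes.\<close>

lemma first_disjoint:
  assumes R: "R \<in> D" shows "disjoint (first R P)"
proof -
  have *: "A = B" if h: "A \<in> gen ch i R" "P i A" "B \<in> gen ch j R" "P j B" "i \<le> j" "x \<in> A" "x \<in> B"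
    "\<forall>i<j. \<forall>Q'\<in>gen ch i R. B \<subseteq> Q' \<longrightarrow> \<not> P i Q'" for A B i j x
  proof -
    obtain C where C: "C \<in> gen ch i R" "B \<in> gen ch (j - i) C"
      using gen_ancestor[OF h(5,3)] by blast
    then have "B \<subseteq> C" using gen_subset gen_nodes[OF R] by blast
    then have "C = A" using gen_unique[OF R C(1) h(1)] h(6,7) by blast
    show ?thesis
    proof (cases "i = j")
      case True then show ?thesis using gen_unique[OF R h(1)] h(3,6,7) by blast
    next
      case False
      then have "i < j" using h(5) by simp
      then show ?thesis using h(1,2,8) \<open>C = A\<close> \<open>B \<subseteq> C\<close> by metis
    qed
  qed
  show ?thesis
  proof (rule disjointI, rule ccontr)
    fix A B assume AB: "A \<in> first R P" "B \<in> first R P" "A \<noteq> B" "A \<inter> B \<noteq> {}"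
    then obtain x where x: "x \<in> A" "x \<in> B" by blast
    obtain i where i: "A \<in> gen ch i R" "P i A" "\<forall>k<i. \<forall>Q'\<in>gen ch k R. A \<subseteq> Q' \<longrightarrow> \<not> P k Q'"
      using AB(1) by (auto simp: first_def)
    obtain j where j: "B \<in> gen ch j R" "P j B" "\<forall>k<j. \<forall>Q'\<in>gen ch k R. B \<subseteq> Q' \<longrightarrow> \<not> P k Q'"
      using AB(2) by (auto simp: first_def)
    show False
      using *[OF i(1,2) j(1,2) _ x j(3)] *[OF j(1,2) i(1,2) _ x(2,1) i(3)] AB(3) linear[of i j] by blast
  qed
qed

text \<open>Passing to maximal nodes loses no point. The least generation is taken for the point
  \<open>x\<close>, not for a chain of sets: an earlier node with \<open>P\<close> above
  \<open>Q\<close> would contain \<open>x\<close> too.\<close>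

lemma Union_first: "\<Union>(first R P) = \<Union>{Q. \<exists>j. Q \<in> gen ch j R \<and> P j Q}"
proof (intro equalityI subsetI)
  fix x assume "x \<in> \<Union>{Q. \<exists>j. Q \<in> gen ch j R \<and> P j Q}"
  then have ex: "\<exists>j. \<exists>Q. Q \<in> gen ch j R \<and> P j Q \<and> x \<in> Q" by blast
  define j where "j = (LEAST j. \<exists>Q. Q \<in> gen ch j R \<and> P j Q \<and> x \<in> Q)"
  from LeastI_ex[OF ex] obtain Q where Q: "Q \<in> gen ch j R" "P j Q" "x \<in> Q"
    unfolding j_def by blast
  have "\<not> P i Q'" if "i < j" "Q' \<in> gen ch i R" "Q \<subseteq> Q'" for i Q'
    using not_less_Least[of i "\<lambda>j. \<exists>Q. Q \<in> gen ch j R \<and> P j Q \<and> x \<in> Q"] that Q(3)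
    unfolding j_def by blast
  then show "x \<in> \<Union>(first R P)" using Q unfolding first_def by blast
qed (auto simp: first_def)

lemma countable_gen: "Q \<in> D \<Longrightarrow> countable (gen ch k Q)"
  using gen_nodes countable_nodes countable_subset by blast

lemma countable_first: "R \<in> D \<Longrightarrow> countable (first R P)"
  using first_nodes countable_nodes countable_subset by blast

lemma sets_layer:
  assumes "D \<subseteq> sets M" "Q \<in> D" shows "layer k Q \<in> sets M"
  unfolding layer_def using gen_nodes[OF assms(2)] countable_gen[OF assms(2)] assms(1)
  by (intro sets.countable_Union) auto

text \<open>The contraction over \<open>K\<close> generations holds at every node, so it can be
  applied inside each node of generation \<open>i * K\<close>. It serves the weight, with 3 blocks
  of \<open>K\<close>, and Lebesgue measure, with \<open>K = 1\<close>.\<close>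

lemma emeasure_layer_power:
  assumes "D \<subseteq> sets M"
    and half: "\<And>Q. Q \<in> D \<Longrightarrow> emeasure M (layer K Q) \<le> c * emeasure M Q"
    and "Q \<in> D"
  shows "emeasure M (layer (i * K) Q) \<le> c ^ i * emeasure M Q"
proof (induction i)
  case (Suc i)
  have "layer (Suc i * K) Q = (\<Union>Q'\<in>gen ch (i * K) Q. layer K Q')"
    using layer_add[of "i * K" K Q] by (simp add: add.commute)
  then have "emeasure M (layer (Suc i * K) Q) = emeasure M (\<Union>Q'\<in>gen ch (i * K) Q. layer K Q')"
    by simp
  also have "\<dots> \<le> c * emeasure M (\<Union>(gen ch (i * K) Q))"
  proof (rule emeasure_Union_le_family)
    show "gen ch (i * K) Q \<subseteq> sets M" using gen_nodes assms by blast
    show "countable (gen ch (i * K) Q)" "disjoint (gen ch (i * K) Q)"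
      using countable_gen gen_disjoint assms by auto
    fix Q' assume "Q' \<in> gen ch (i * K) Q"
    then have "Q' \<in> D" using gen_nodes assms by blast
    then show "layer K Q' \<in> sets M" "layer K Q' \<subseteq> Q'" "emeasure M (layer K Q') \<le> c * emeasure M Q'"
      using sets_layer layer_subset assms by auto
  qed
  also have "\<dots> \<le> c * (c ^ i * emeasure M Q)"
    using Suc by (intro mult_left_mono) (auto simp: layer_def)
  finally show ?case by (simp add: mult.assoc)
qed auto

end

section \<open>A good-lambda inequality for sums along the paths of a tree\<close>

lemma powr_one_plus_inverse_le:
  fixes p :: real assumes "0 < p" shows "(1 + 1 / p) powr p \<le> 3"
proof -
  have "(1 + 1 / p) powr p = exp (p * ln (1 + 1 / p))"
    using assms by (simp add: powr_def add_pos_pos less_imp_neq[symmetric])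
  also have "p * ln (1 + 1 / p) \<le> p * (1 / p)"
    using assms by (intro mult_left_mono ln_add_one_self_le_self) auto
  then have "exp (p * ln (1 + 1 / p)) \<le> exp (p * (1 / p))" by simp
  also have "\<dots> \<le> 3" using assms exp_le by simp
  finally show ?thesis .
qed

text \<open>Iterating \<open>\<psi>(r t) \<le> \<psi>(t) / 2 + M / 2\<close> downwards; \<open>\<psi>(t) \<le> C t\<^sup>p\<close> makes the remainder vanish.\<close>

lemma good_lambda_iterate:
  fixes \<phi> :: "real \<Rightarrow> real"
  assumes p: "0 < p" and C: "\<And>t. 0 < t \<Longrightarrow> \<phi> t \<le> C" and "0 \<le> E"
    and step: "\<And>t. 0 < t \<Longrightarrow> \<phi> ((1 + 1 / p) * t) \<le> E / t powr p + \<phi> t / 8"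
    and t: "0 < t"
  shows "\<phi> t \<le> 8 * E / t powr p"
proof -
  define r where "r = 1 + 1 / p"
  have r: "r > 1" using p by (simp add: r_def)
  have rp: "r powr p \<le> 3" unfolding r_def by (rule powr_one_plus_inverse_le[OF p])
  \<comment> \<open>In the induction step \<open>r powr p\<close> turns \<open>s powr p\<close> into
    \<open>t powr p\<close>, so the remainder is divided by 8, of which a factor 2 is kept. The
    bound \<open>8 * E\<close> reproduces itself because
    \<open>r powr p * (E + 8 * E / 8) \<le> 3 * (2 * E) \<le> 8 * E\<close>.\<close>
  have nn: "t powr p * \<phi> t \<le> (1/2) ^ n * (t powr p * max 0 C) + 8 * E" if "0 < t" for n t
    using that
  proof (induction n arbitrary: t)
    case 0
    have "t powr p * \<phi> t \<le> t powr p * max 0 C"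
      using C[OF 0] by (intro mult_left_mono) auto
    then show ?case using \<open>0 \<le> E\<close> by simp
  next
    case (Suc n)
    define s where "s = t / r"
    have s: "0 < s" "t = r * s" using Suc.prems r by (auto simp: s_def)
    have tp: "t powr p = r powr p * s powr p" using s r by (simp add: powr_mult)
    define X where "X = (1/2) ^ n * (s powr p * max 0 C)"
    have IH: "s powr p * \<phi> s \<le> X + 8 * E" unfolding X_def using Suc.IH[OF s(1)] .
    have "X \<ge> 0" by (auto simp: X_def)
    have "t powr p * \<phi> t \<le> t powr p * (E / s powr p + \<phi> s / 8)"
      using step[OF s(1)] s(2) by (intro mult_left_mono) (auto simp: r_def)
    also have "\<dots> = r powr p * (E + s powr p * \<phi> s / 8)"
      using s(1) unfolding tp by (simp add: field_simps)
    also have "\<dots> \<le> r powr p * (E + (X + 8 * E) / 8)"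
      using IH by (intro mult_left_mono) auto
    also have "\<dots> = r powr p * (2 * E) + r powr p * X / 8" by (simp add: algebra_simps)
    also have "\<dots> \<le> 3 * (2 * E) + r powr p * X / 2"
      using rp \<open>0 \<le> E\<close> \<open>X \<ge> 0\<close> by (intro add_mono mult_right_mono) auto
    also have "\<dots> \<le> (1/2) ^ Suc n * (t powr p * max 0 C) + 8 * E"
      using \<open>0 \<le> E\<close> by (simp add: X_def tp algebra_simps)
    finally show ?case .
  qed
  have "(\<lambda>n. (1/2::real) ^ n * (t powr p * max 0 C) + 8 * E) \<longlonglongrightarrow> 0 * (t powr p * max 0 C) + 8 * E"
    by (intro tendsto_intros LIMSEQ_realpow_zero) auto
  then have "t powr p * \<phi> t \<le> 0 * (t powr p * max 0 C) + 8 * E"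
    by (rule LIMSEQ_le_const) (use nn[OF t] in auto)
  then show ?thesis using t by (simp add: field_simps)
qed

locale weighted_tree = set_tree D ch for D :: "'a set set" and ch +
  fixes M :: "'a measure" and R :: "'a set" and a :: "'a set \<Rightarrow> real"
  assumes finite_M: "finite_measure M"
    and nodes_sets: "D \<subseteq> sets M"
    and root: "R \<in> D"
    and a_pos: "Q \<in> D \<Longrightarrow> 0 < a Q"
begin

text \<open>At most one node of a generation contains \<open>x\<close>, so the choice is unique. The
  default 0 beyond the last generation containing \<open>x\<close> makes \<open>path_sum\<close>
  constant from there on.\<close>

definition value_at :: "nat \<Rightarrow> 'a \<Rightarrow> real" where
  "value_at k x = (if x \<in> layer k R then a (SOME Q. Q \<in> gen ch k R \<and> x \<in> Q) else 0)"

definition path_sum :: "nat \<Rightarrow> 'a \<Rightarrow> real" where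
  "path_sum k x = (\<Sum>j\<le>k. value_at j x)"

text \<open>As the values are nonnegative, this is the set where their possibly infinite sum over
  all generations exceeds \<open>t\<close>; partial sums avoid the value infinity.\<close>

definition superlevel :: "real \<Rightarrow> 'a set" where
  "superlevel t = {x. \<exists>k. t < path_sum k x}"

lemma value_at_eq: "Q \<in> gen ch k R \<Longrightarrow> x \<in> Q \<Longrightarrow> value_at k x = a Q"
proof -
  assume Q: "Q \<in> gen ch k R" "x \<in> Q"
  have "(SOME Q. Q \<in> gen ch k R \<and> x \<in> Q) = Q"
    using Q gen_unique[OF root] by (intro some_equality) blast+
  then show ?thesis using Q by (auto simp: value_at_def layer_def)
qed

lemma value_at_nonneg: "0 \<le> value_at k x"
proof (cases "x \<in> layer k R")
  case True
  then obtain Q where Q: "Q \<in> gen ch k R" "x \<in> Q" by (auto simp: layer_def)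
  then show ?thesis using value_at_eq[OF Q] a_pos gen_nodes[OF root] by (simp add: subset_eq less_imp_le)
qed (simp add: value_at_def)

lemma path_sum_mono: "i \<le> j \<Longrightarrow> path_sum i x \<le> path_sum j x"
  unfolding path_sum_def by (rule sum_mono2) (auto simp: value_at_nonneg)

text \<open>In each generation up to \<open>k\<close> one node contains \<open>Q\<close>, and it
  serves both points. So a node can be selected by the partial sum at any one of its points.\<close>

lemma path_sum_const:
  assumes Q: "Q \<in> gen ch k R" "x \<in> Q" "y \<in> Q" shows "path_sum k x = path_sum k y"
  unfolding path_sum_def
proof (rule sum.cong)
  fix j assume "j \<in> {..k}"
  then obtain P where "P \<in> gen ch j R" "Q \<in> gen ch (k - j) P" using gen_ancestor Q by blast
  moreover from this have "Q \<subseteq> P" using gen_subset gen_nodes[OF root] by blast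
  ultimately show "value_at j x = value_at j y" using value_at_eq Q by (metis subsetD)
qed simp

text \<open>The sum may exceed \<open>t\<close> at an index where \<open>x\<close> has already left
  the tree. At the least index where it does, the last term must be positive, so a node of that
  generation contains \<open>x\<close>; \<open>0 < t\<close> covers index 0.\<close>

lemma path_sum_witness:
  assumes "0 < t" "t < path_sum k x"
  shows "\<exists>j Q. Q \<in> gen ch j R \<and> x \<in> Q \<and> t < path_sum j x"
proof -
  define j where "j = (LEAST j. t < path_sum j x)"
  have j: "t < path_sum j x" unfolding j_def by (rule LeastI) (rule assms(2))
  have "x \<in> layer j R"
  proof (rule ccontr)
    assume "x \<notin> layer j R"
    then have v: "value_at j x = 0" by (simp add: value_at_def)
    show False
    proof (cases j)
      case 0 then show False using j v assms by (simp add: path_sum_def)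
    next
      case (Suc i)
      then have "path_sum j x = path_sum i x" using v by (simp add: path_sum_def)
      then have "j \<le> i" using j unfolding j_def by (intro Least_le) simp
      then show False using Suc by simp
    qed
  qed
  then show ?thesis using j by (auto simp: layer_def)
qed

lemma superlevel_eq:
  assumes "0 < t"
  shows "superlevel t = \<Union>(first R (\<lambda>k Q. \<exists>x\<in>Q. t < path_sum k x))"
  unfolding Union_first
proof (intro equalityI subsetI)
  fix x assume "x \<in> superlevel t"
  then obtain k where "t < path_sum k x" by (auto simp: superlevel_def)
  then show "x \<in> \<Union>{Q. \<exists>j. Q \<in> gen ch j R \<and> (\<exists>x\<in>Q. t < path_sum j x)}"
    using path_sum_witness[OF assms] by blast
next
  fix x assume "x \<in> \<Union>{Q. \<exists>j. Q \<in> gen ch j R \<and> (\<exists>x\<in>Q. t < path_sum j x)}"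
  then obtain j Q y where "Q \<in> gen ch j R" "x \<in> Q" "y \<in> Q" "t < path_sum j y" by blast
  then show "x \<in> superlevel t" using path_sum_const[of Q j x y] unfolding superlevel_def by (metis mem_Collect_eq)
qed

lemma sets_first: "\<Union>(first R P) \<in> sets M"
  using first_nodes[OF root] countable_first[OF root] nodes_sets by (intro sets.countable_Union) auto

text \<open>Chebyshev's inequality on a disjoint family. \<open>DP\<close> speaks of finite
  families, so a countable \<open>V\<close> is exhausted by finite subfamilies and the bound passes
  to the limit.\<close>

lemma measure_large_family:
  assumes p: "0 < p" and s: "0 < s" and B: "0 \<le> B"
    and DP: "\<And>F. finite F \<Longrightarrow> F \<subseteq> D \<Longrightarrow> disjoint F \<Longrightarrow>
      (\<Sum>Q\<in>F. a Q powr p * measure M Q) \<le> B powr p * measure M R"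
    and V: "V \<subseteq> D" "disjoint V" "\<And>Q. Q \<in> V \<Longrightarrow> s < a Q"
  shows "measure M (\<Union>V) \<le> (B / s) powr p * measure M R"
proof (cases "V = {}")
  case False
  interpret finite_measure M by (rule finite_M)
  have cV: "countable V" using V countable_nodes countable_subset by blast
  define U where "U n = \<Union>(from_nat_into V ` {..<n})" for n
  have UV: "(\<Union>n. U n) = \<Union>V"
  proof -
    have "(\<Union>n. U n) = \<Union>(range (from_nat_into V))" by (auto simp: U_def)
    then show ?thesis using range_from_nat_into[OF False cV] by simp
  qed
  have V': "from_nat_into V n \<in> V" for n using from_nat_into[OF False] .
  have meas: "U n \<in> sets M" for n
    unfolding U_def using V V' nodes_sets by (intro sets.finite_Union) auto
  have Un: "measure M (U n) \<le> (B / s) powr p * measure M R" for n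
  proof -
    \<comment> \<open>An enumeration of a finite \<open>V\<close> repeats its members; the sum is
      therefore taken over the image, not over the indices.\<close>
    define F where "F = from_nat_into V ` {..<n}"
    have F: "finite F" "F \<subseteq> V" using V' by (auto simp: F_def)
    then have dF: "disjoint F" using V(2) by (auto simp: disjoint_def)
    have "measure M (U n) = (\<Sum>Q\<in>F. measure M Q)"
      unfolding U_def F_def[symmetric]
      using finite_measure_finite_Union[OF F(1), of "\<lambda>x. x"] F dF V nodes_sets
      by (auto simp: disjoint_family_on_def disjoint_def subset_eq)
    also have "s powr p * \<dots> \<le> (\<Sum>Q\<in>F. a Q powr p * measure M Q)"
      unfolding sum_distrib_left using F V s p
      by (intro sum_mono mult_right_mono powr_mono2) (auto simp: less_imp_le)
    also have "\<dots> \<le> B powr p * measure M R" using DP F dF V(1) by blast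
    finally show ?thesis using s B by (simp add: powr_divide field_simps)
  qed
  have "(\<lambda>n. measure M (U n)) \<longlonglongrightarrow> measure M (\<Union>n. U n)"
    by (rule finite_Lim_measure_incseq) (use meas in \<open>force simp: incseq_def U_def\<close>)+
  then show ?thesis unfolding UV by (rule LIMSEQ_le_const2) (use Un in auto)
qed simp

text \<open>\<open>3 * K\<close> generations reduce the measure by (1/2)^3 = 1/8, the factor
  required by \<open>good_lambda_iterate\<close>, where the ratio between the levels costs at most
  3.\<close>

lemma superlevel_bound:
  assumes p: "0 < p" and B: "0 \<le> B"
    and DP: "\<And>F. finite F \<Longrightarrow> F \<subseteq> D \<Longrightarrow> disjoint F \<Longrightarrow>
      (\<Sum>Q\<in>F. a Q powr p * measure M Q) \<le> B powr p * measure M R"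
    and half: "\<And>Q. Q \<in> D \<Longrightarrow> emeasure M (layer K Q) \<le> ennreal (1/2) * emeasure M Q"
    and t: "0 < t"
  shows "measure M (superlevel t) \<le> 8 * (B * p * (3 * real K + 1) / t) powr p * measure M R"
proof -
  interpret finite_measure M by (rule finite_M)
  \<comment> \<open>Chosen so that \<open>3 * K + 1\<close> increments of size
    \<open>\<epsilon> * t\<close> add up to \<open>t / p\<close>, the distance between the two
    levels. The extra 1 pays for the generation at which \<open>t\<close> is first passed.\<close>
  define \<epsilon> where "\<epsilon> = 1 / (p * (3 * real K + 1))"
  have \<epsilon>: "0 < \<epsilon>" using p by (simp add: \<epsilon>_def)
  have "\<epsilon> * (3 * real K + 1) = 1 / p" unfolding \<epsilon>_def by (simp add: add_nonneg_pos less_imp_neq[symmetric])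
  then have \<epsilon>_eq: "1 / p = \<epsilon> + real (3 * K) * \<epsilon>" by (simp add: algebra_simps)
  define E where "E = (B / \<epsilon>) powr p * measure M R"
  have step: "measure M (superlevel ((1 + 1 / p) * t)) \<le> E / t powr p + measure M (superlevel t) / 8"
    if t: "0 < t" for t
  proof -
    define V where "V = first R (\<lambda>k Q. \<exists>x\<in>Q. t < path_sum k x)"
    define V1 where "V1 = first R (\<lambda>k Q. \<epsilon> * t < a Q)"
    define G where "G = (\<Union>Q\<in>V. layer (3 * K) Q)"
    have VD: "V \<subseteq> D" unfolding V_def by (rule first_nodes[OF root])
    have Vsup: "superlevel t = \<Union>V" unfolding V_def by (rule superlevel_eq[OF t])
    have Gs: "G \<in> sets M" unfolding G_def
      using VD countable_first[OF root] sets_layer[OF nodes_sets]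
      by (intro sets.countable_UN'') (auto simp: V_def)
    (* A point where every a-value is at most \<epsilon> t needs more than 3 K further generations
       to climb from the stopping level t to (1 + 1/p) t. *)
    have sub: "superlevel ((1 + 1 / p) * t) \<subseteq> \<Union>V1 \<union> G"
    proof
      fix x assume x: "x \<in> superlevel ((1 + 1 / p) * t)"
      show "x \<in> \<Union>V1 \<union> G"
      proof (cases "x \<in> \<Union>V1")
        case False
        have small: "value_at j x \<le> \<epsilon> * t" for j
        proof (cases "x \<in> layer j R")
          case True
          then obtain Q where Q: "Q \<in> gen ch j R" "x \<in> Q" by (auto simp: layer_def)
          then have "\<not> \<epsilon> * t < a Q" using False unfolding V1_def Union_first by blast
          then show ?thesis using value_at_eq[OF Q] by simp
        qed (use \<epsilon> t in \<open>simp add: value_at_def\<close>)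
        obtain N where N: "(1 + 1 / p) * t < path_sum N x" using x by (auto simp: superlevel_def)
        have "t \<le> (1 + 1 / p) * t" using p t by (simp add: field_simps)
        then have "t < path_sum N x" using N by simp
        then have "x \<in> superlevel t" by (auto simp: superlevel_def)
        then obtain Q where QV: "Q \<in> V" "x \<in> Q" using Vsup by blast
        then obtain k y where Q: "Q \<in> gen ch k R" "y \<in> Q" "t < path_sum k y"
          "\<And>i Q'. i < k \<Longrightarrow> Q' \<in> gen ch i R \<Longrightarrow> Q \<subseteq> Q' \<Longrightarrow> \<not> (\<exists>x\<in>Q'. t < path_sum i x)"
          unfolding V_def first_def by blast
        \<comment> \<open>Overshoot: by minimality of \<open>Q\<close> the sum is at most
          \<open>t\<close> one generation earlier, so passing \<open>t\<close> costs one
          increment.\<close>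
        have prev: "path_sum k x \<le> t + \<epsilon> * t"
        proof (cases k)
          case 0
          then show ?thesis using small[of 0] t by (simp add: path_sum_def)
        next
          case (Suc i)
          obtain P where P: "P \<in> gen ch i R" "Q \<in> gen ch (k - i) P"
            using gen_ancestor[of i k] Suc Q by auto
          then have "Q \<subseteq> P" using gen_subset gen_nodes[OF root] by blast
          then have "path_sum i x \<le> t" using Q(4)[of i P] P Suc QV by force
          then show ?thesis using small[of k] Suc by (simp add: path_sum_def)
        qed
        have deep: "x \<in> layer (k + 3 * K) R"
        proof (rule ccontr)
          assume n: "x \<notin> layer (k + 3 * K) R"
          \<comment> \<open>\<open>N\<close> may be smaller than \<open>k + 3 * K\<close>. The
            padded index lies beyond both, and all values after generation \<open>k + 3 * K\<close>
            are 0.\<close>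
          have "path_sum N x \<le> path_sum (k + 3 * K + N) x" by (rule path_sum_mono) simp
          also have "\<dots> = path_sum (k + 3 * K) x"
          proof -
            have "value_at j x = 0" if "j > k + 3 * K" for j
              using n layer_antimono[OF root, of "k + 3 * K" j] that
              by (auto simp: value_at_def)
            then show ?thesis unfolding path_sum_def by (intro sum.mono_neutral_right) auto
          qed
          also have "\<dots> = path_sum k x + (\<Sum>j\<in>{k<..k + 3 * K}. value_at j x)"
          proof -
            have "{..k + 3 * K} = {..k} \<union> {k<..k + 3 * K}" by auto
            then show ?thesis unfolding path_sum_def by (auto intro: sum.union_disjoint)
          qed
          also have "\<dots> \<le> (t + \<epsilon> * t) + (\<Sum>j\<in>{k<..k + 3 * K}. \<epsilon> * t)"
            using prev small by (intro add_mono sum_mono) auto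
          also have "\<dots> = (1 + (\<epsilon> + real (3 * K) * \<epsilon>)) * t" by (simp add: algebra_simps)
          also have "\<dots> = (1 + 1 / p) * t" using \<epsilon>_eq by simp
          finally show False using N by simp
        qed
        then obtain Q' where Q': "Q' \<in> gen ch k R" "x \<in> layer (3 * K) Q'" unfolding layer_add by blast
        then have "x \<in> Q'" using layer_subset gen_nodes[OF root] by blast
        then have "Q' = Q" using gen_unique[OF root] Q' Q QV by blast
        then show ?thesis using Q' QV unfolding G_def by blast
      qed simp
    qed
    have "measure M (superlevel ((1 + 1 / p) * t)) \<le> measure M (\<Union>V1 \<union> G)"
      using sub Gs sets_first by (intro finite_measure_mono) (auto simp: V1_def)
    also have "\<dots> \<le> measure M (\<Union>V1) + measure M G"
      using Gs sets_first by (intro measure_Un_le) (auto simp: V1_def)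
    \<comment> \<open>The place where \<open>DP\<close> enters: the maximal nodes with a large value
      are disjoint, as D_p demands.\<close>
    also have "measure M (\<Union>V1) \<le> (B / (\<epsilon> * t)) powr p * measure M R"
      unfolding V1_def using \<epsilon> t
      by (intro measure_large_family[OF p _ B DP] first_nodes root first_disjoint)
         (auto simp: first_def)
    also have "\<dots> = E / t powr p"
      using \<epsilon> t B by (simp add: E_def powr_divide powr_mult)
    also have "measure M G \<le> measure M (superlevel t) / 8"
    proof -
      have "emeasure M G \<le> ennreal (1/2) ^ 3 * emeasure M (\<Union>V)"
        unfolding G_def
      proof (rule emeasure_Union_le_family)
        show "countable V" "disjoint V" "V \<subseteq> sets M"
          using countable_first first_disjoint root VD nodes_sets by (auto simp: V_def)
        fix Q assume "Q \<in> V"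
        then have "Q \<in> D" using VD by blast
        then show "layer (3 * K) Q \<in> sets M" "layer (3 * K) Q \<subseteq> Q"
          "emeasure M (layer (3 * K) Q) \<le> ennreal (1/2) ^ 3 * emeasure M Q"
          using sets_layer[OF nodes_sets] layer_subset emeasure_layer_power[OF nodes_sets half] by auto
      qed
      moreover have "ennreal (1/2) ^ 3 = ennreal ((1/2) ^ 3)" by (rule ennreal_power) simp
      ultimately have "ennreal (measure M G) \<le> ennreal ((1/2)^3 * measure M (\<Union>V))"
        by (simp only: emeasure_eq_measure ennreal_mult'' measure_nonneg)
      then have "measure M G \<le> (1/2)^3 * measure M (\<Union>V)"
        by (subst (asm) ennreal_le_iff) auto
      then show ?thesis by (simp add: Vsup power3_eq_cube)
    qed
    finally show ?thesis by simp
  qed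
  \<comment> \<open>The total mass is the crude bound that starts the iteration.\<close>
  have "measure M (superlevel t) \<le> 8 * E / t powr p"
    by (rule good_lambda_iterate[where C = "measure M (space M)" and p = p])
       (use p t step in \<open>auto simp: E_def bounded_measure\<close>)
  also have "\<dots> = 8 * (B / \<epsilon> / t) powr p * measure M R"
    using \<epsilon> t B by (simp add: E_def powr_divide powr_mult)
  also have "B / \<epsilon> / t = B * p * (3 * real K + 1) / t" unfolding \<epsilon>_def by simp
  finally show ?thesis .
qed

end

section \<open>Dyadic subrectangles and the Calderon-Zygmund decomposition\<close>

text \<open>A rectangle may contain any faces of its boundary, so it is known only up to the
  sandwich between an open and a closed box. The sandwich determines side lengths, midpoints and
  measure, since the difference is negligible.\<close>

definition has_corners :: "(real ^ 'n) set \<Rightarrow> real ^ 'n \<Rightarrow> real ^ 'n \<Rightarrow> bool" where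
  "has_corners Q l u \<longleftrightarrow> Q \<in> rectangles \<and> (\<forall>i. l $ i < u $ i) \<and> box l u \<subseteq> Q \<and> Q \<subseteq> cbox l u"

lemma Inf_Sup_between:
  fixes S :: "real set"
  assumes "{l<..<u} \<subseteq> S" "S \<subseteq> {l..u}" "l < u"
  shows "Inf S = l" "Sup S = u"
proof -
  have bdd: "bdd_below S" "bdd_above S" using assms(2) by (auto intro: bdd_below_mono bdd_above_mono)
  have ne: "{l<..<u} \<noteq> {}" "S \<noteq> {}" using assms by auto
  show "Inf S = l"
  proof (rule antisym)
    show "Inf S \<le> l" using cInf_superset_mono[OF ne(1) bdd(1) assms(1)] assms(3) by simp
    show "l \<le> Inf S" using assms(2) by (intro cInf_greatest ne) auto
  qed
  show "Sup S = u"
  proof (rule antisym)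
    show "u \<le> Sup S" using cSup_subset_mono[OF ne(1) bdd(2) assms(1)] assms(3) by simp
    show "Sup S \<le> u" using assms(2) by (intro cSup_least ne) auto
  qed
qed

lemma interval_between:
  fixes I :: "real set"
  assumes "is_interval I" "bounded I" "interior I \<noteq> {}"
  shows "\<exists>l u. l < u \<and> {l<..<u} \<subseteq> I \<and> I \<subseteq> {l..u}"
proof (intro exI conjI)
  have bdd: "bdd_below I" "bdd_above I"
    using assms(2) bounded_imp_bdd_below bounded_imp_bdd_above by auto
  obtain x e where x: "0 < e" "cball x e \<subseteq> I" using assms(3) by (auto simp: mem_interior_cball)
  then have xe: "x - e \<in> I" "x + e \<in> I" by (auto simp: subset_eq dist_real_def)
  then have ne: "I \<noteq> {}" by blast
  show "Inf I < Sup I"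
    using cInf_lower[OF xe(1) bdd(1)] cSup_upper[OF xe(2) bdd(2)] x(1) by linarith
  show "{Inf I<..<Sup I} \<subseteq> I"
  proof
    fix y assume "y \<in> {Inf I<..<Sup I}"
    then obtain a b where "a \<in> I" "a < y" "b \<in> I" "y < b"
      using cInf_lessD[OF ne] less_cSupD[OF ne] by (metis greaterThanLessThan_iff)
    then show "y \<in> I" using assms(1) mem_is_interval_1_I[of I a b y] by simp
  qed
  show "I \<subseteq> {Inf I..Sup I}" using bdd by (auto intro: cInf_lower cSup_upper)
qed

lemma rectangles_sides:
  assumes "Q \<in> rectangles"
  shows "\<exists>I. Q = {x. \<forall>i. x $ i \<in> I i} \<and>
    (\<forall>i. is_interval (I i) \<and> bounded (I i) \<and> interior (I i) \<noteq> {})"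
  using assms unfolding rectangles_def by (rule CollectD)

lemma rectangles_corners:
  assumes "Q \<in> rectangles" shows "\<exists>l u. has_corners Q l u"
proof -
  obtain I where I: "Q = {x. \<forall>i. x $ i \<in> I i}"
    "\<forall>i. is_interval (I i) \<and> bounded (I i) \<and> interior (I i) \<noteq> {}"
    using rectangles_sides[OF assms] by (elim exE conjE) (rule that)
  have "\<forall>i. \<exists>l u. l < u \<and> {l<..<u} \<subseteq> I i \<and> I i \<subseteq> {l..u}"
    by (intro allI interval_between) (use I(2) in auto)
  then obtain l u where lu: "\<And>i. l i < u i \<and> {l i<..<u i} \<subseteq> I i \<and> I i \<subseteq> {l i..u i}" by metis
  have "has_corners Q (\<chi> i. l i) (\<chi> i. u i)"
    unfolding has_corners_def using assms lu unfolding I(1)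
    by (auto simp: mem_box_cart subset_eq)
  then show ?thesis by blast
qed

lemma midpt_corners:
  assumes "has_corners Q l u" shows "midpt Q i = (l $ i + u $ i) / 2"
proof -
  define S where "S = (\<lambda>x. x $ i) ` Q"
  have lu: "\<And>i. l $ i < u $ i" "box l u \<subseteq> Q" "Q \<subseteq> cbox l u" using assms by (auto simp: has_corners_def)
  have "{l $ i<..<u $ i} \<subseteq> S"
  proof
    fix v assume v: "v \<in> {l $ i<..<u $ i}"
    \<comment> \<open>Prescribing one coordinate and centring the others shows that the open box
      projects onto the whole open side.\<close>
    have "(\<chi> j. if j = i then v else (l $ j + u $ j) / 2) \<in> box l u"
      using v lu(1) by (auto simp: mem_box_cart field_simps)
    then show "v \<in> S" unfolding S_def using lu(2) by (force simp: image_iff)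
  qed
  moreover have "S \<subseteq> {l $ i..u $ i}" using lu(3) by (auto simp: S_def mem_box_cart subset_eq)
  ultimately show ?thesis unfolding midpt_def S_def[symmetric] using Inf_Sup_between lu(1) by metis
qed

text \<open>Halving keeps a rectangle nondegenerate, so it can be repeated. The corners give the
  lengths; membership in \<open>rectangles\<close> needs the sides themselves, each cut by a
  half-line at the midpoint.\<close>

lemma child_corners:
  fixes Q :: "(real ^ 'n) set"
  assumes Q: "has_corners Q l u" and Q': "Q' \<in> dyadic_children Q"
  shows "\<exists>l' u'. has_corners Q' l' u' \<and> (\<forall>i. u' $ i - l' $ i = (u $ i - l $ i) / 2)"
proof -
  have lu: "\<And>i. l $ i < u $ i" "box l u \<subseteq> Q" "Q \<subseteq> cbox l u" "Q \<in> rectangles"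
    using Q by (auto simp: has_corners_def)
  define c where "c i = (l $ i + u $ i) / 2" for i
  obtain A where A: "Q' = {x \<in> Q. \<forall>i. if i \<in> A then c i \<le> x $ i else x $ i < c i}"
    using Q' unfolding dyadic_children_def midpt_corners[OF Q] c_def by auto
  define l' where "l' = (\<chi> i. if i \<in> A then c i else l $ i)"
  define u' where "u' = (\<chi> i. if i \<in> A then u $ i else c i)"
  have lt: "l' $ i < u' $ i" "u' $ i - l' $ i = (u $ i - l $ i) / 2" for i
    using lu(1)[of i] by (auto simp: l'_def u'_def c_def field_simps)
  have sub: "box l' u' \<subseteq> Q'"
  proof
    fix x assume x: "x \<in> box l' u'"
    have xi: "l' $ i < x $ i \<and> x $ i < u' $ i" for i using x by (simp add: mem_box_cart)
    have "l $ i < x $ i \<and> x $ i < u $ i" for i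
      using xi[of i] lu(1)[of i] by (auto simp: l'_def u'_def c_def field_simps split: if_splits)
    then have "x \<in> Q" using lu(2) by (auto simp: mem_box_cart subset_eq)
    moreover have "if i \<in> A then c i \<le> x $ i else x $ i < c i" for i
      using xi[of i] by (auto simp: l'_def u'_def split: if_splits)
    ultimately show "x \<in> Q'" unfolding A by blast
  qed
  have sup: "Q' \<subseteq> cbox l' u'"
  proof
    fix x assume x: "x \<in> Q'"
    then have "x \<in> cbox l u" using lu(3) A by blast
    then show "x \<in> cbox l' u'" using x unfolding A mem_box_cart l'_def u'_def
      by (auto split: if_splits intro: less_imp_le)
  qed
  obtain I where I: "Q = {x. \<forall>i. x $ i \<in> I i}"
    "\<forall>i. is_interval (I i) \<and> bounded (I i) \<and> interior (I i) \<noteq> {}"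
    using rectangles_sides[OF lu(4)] by (elim exE conjE) (rule that)
  define J where "J i = I i \<inter> (if i \<in> A then {c i..} else {..<c i})" for i
  have QJ: "Q' = {x. \<forall>i. x $ i \<in> J i}" unfolding A I(1) J_def by (auto split: if_splits)
  have "is_interval (J i)" for i
    unfolding J_def using I(2) by (auto intro!: is_interval_Int is_interval_ci is_interval_io split: if_splits)
  moreover have "bounded (J i)" for i unfolding J_def using I(2) bounded_subset by blast
  moreover have "interior (J i) \<noteq> {}" for i
  proof -
    have "{l' $ i<..<u' $ i} \<subseteq> J i"
    proof
      fix v assume v: "v \<in> {l' $ i<..<u' $ i}"
      have "(\<chi> j. if j = i then v else (l' $ j + u' $ j) / 2) \<in> box l' u'"
        using v lt(1) by (auto simp: mem_box_cart field_simps)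
      then have "(\<chi> j. if j = i then v else (l' $ j + u' $ j) / 2) \<in> Q'" using sub by blast
      then show "v \<in> J i" unfolding QJ by (auto dest!: spec[of _ i])
    qed
    then have "{l' $ i<..<u' $ i} \<subseteq> interior (J i)" by (simp add: interior_maximal)
    then show ?thesis using lt(1)[of i] by (metis dense greaterThanLessThan_iff empty_iff subset_empty)
  qed
  ultimately have "Q' \<in> rectangles" unfolding rectangles_def QJ by blast
  then show ?thesis using lt sub sup by (auto simp: has_corners_def)
qed

lemma corners_measurable:
  fixes Q :: "(real ^ 'n) set"
  assumes "has_corners Q l u"
  shows "Q \<in> lmeasurable" "negligible (cbox l u - Q)"
    "measure lebesgue Q = (\<Prod>i\<in>UNIV. u $ i - l $ i)" "0 < measure lebesgue Q"
proof -
  have lu: "\<And>i. l $ i < u $ i" "box l u \<subseteq> Q" "Q \<subseteq> cbox l u" using assms by (auto simp: has_corners_def)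
  have neg: "negligible (cbox l u - box l u)" by (rule negligible_frontier_interval)
  show neg': "negligible (cbox l u - Q)" by (rule negligible_subset[OF neg]) (use lu in auto)
  have eq: "Q = cbox l u - (cbox l u - Q)" using lu by blast
  show Q: "Q \<in> lmeasurable"
    by (subst eq) (intro fmeasurable.Diff lmeasurable_cbox negligible_imp_measurable neg')
  have "measure lebesgue Q = measure lebesgue (cbox l u)"
    by (rule measure_negligible_symdiff[OF lmeasurable_cbox])
       (use neg' lu in \<open>auto simp: Un_absorb1 Diff_eq_empty_iff\<close>)
  also have "\<dots> = (\<Prod>i\<in>UNIV. u $ i - l $ i)"
    using lu(1) by (subst measure_completion) (auto simp: content_cbox_cart interval_ne_empty_cart less_imp_le)
  finally show m: "measure lebesgue Q = (\<Prod>i\<in>UNIV. u $ i - l $ i)" .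
  show "0 < measure lebesgue Q" unfolding m using lu(1) by (intro prod_pos) auto
qed

section \<open>The tree of dyadic subrectangles\<close>

lemma dyadic_children_rectangles:
  "Q \<in> rectangles \<Longrightarrow> Q' \<in> dyadic_children Q \<Longrightarrow> Q' \<in> rectangles"
  using rectangles_corners child_corners has_corners_def by blast

lemma dyadic_subrectangles_rectangles:
  assumes "Q \<in> dyadic_subrectangles R" "R \<in> rectangles" shows "Q \<in> rectangles"
  using assms by induction (auto intro: dyadic_children_rectangles)

lemma dyadic_subrectangles_trans:
  assumes "P \<in> dyadic_subrectangles Q" "Q \<in> dyadic_subrectangles R"
  shows "P \<in> dyadic_subrectangles R"
  using assms by induction (auto intro: dyadic_subrectangles.intros)

text \<open>Numbers the generations of the inductive definition, which makes maximal dyadic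
  rectangles available through \<open>first\<close>.\<close>

lemma dyadic_subrectangles_gen: "dyadic_subrectangles R = (\<Union>k. gen dyadic_children k R)"
proof (intro equalityI subsetI)
  fix Q assume "Q \<in> dyadic_subrectangles R"
  then show "Q \<in> (\<Union>k. gen dyadic_children k R)"
  proof induction
    case self
    have "R \<in> gen dyadic_children 0 R" by simp
    then show ?case by blast
  next
    case (bisect Q Q')
    then obtain k where "Q \<in> gen dyadic_children k R" by blast
    then have "Q' \<in> gen dyadic_children (Suc k) R" using bisect by auto
    then show ?case by blast
  qed
next
  have "gen dyadic_children k R \<subseteq> dyadic_subrectangles R" for k
    by (induction k) (auto intro: dyadic_subrectangles.intros)
  then show "Q \<in> dyadic_subrectangles R" if "Q \<in> (\<Union>k. gen dyadic_children k R)" for Q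
    using that by blast
qed

lemma finite_dyadic_children: "finite (dyadic_children (Q :: (real ^ 'n) set))"
proof -
  have "dyadic_children Q =
    range (\<lambda>A. {x \<in> Q. \<forall>i. if i \<in> A then midpt Q i \<le> x $ i else x $ i < midpt Q i})"
    by (auto simp: dyadic_children_def)
  then show ?thesis by simp
qed

lemma Union_dyadic_children: "\<Union>(dyadic_children Q) = Q"
proof (intro equalityI subsetI)
  fix x assume x: "x \<in> Q"
  define A where "A = {i. midpt Q i \<le> x $ i}"
  have "x \<in> {x \<in> Q. \<forall>i. if i \<in> A then midpt Q i \<le> x $ i else x $ i < midpt Q i}"
    using x by (auto simp: A_def)
  then show "x \<in> \<Union>(dyadic_children Q)" unfolding dyadic_children_def
    by (rule UnionI[rotated]) (rule CollectI, rule exI[of _ A], simp)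
qed (auto simp: dyadic_children_def)

lemma countable_dyadic_subrectangles: "countable (dyadic_subrectangles R)"
proof -
  have "finite (gen dyadic_children k R)" for k
    by (induction k) (auto simp: finite_dyadic_children)
  then show ?thesis unfolding dyadic_subrectangles_gen
    by (intro countable_UN) (auto simp: countable_finite)
qed

text \<open>Disjointness rests on the midpoint convention: two children differ in a coordinate where
  one requires \<open>\<ge>\<close> and the other \<open><\<close>.\<close>

lemma dyadic_set_tree: "set_tree (dyadic_subrectangles R) dyadic_children"
proof
  fix Q :: "(real ^ 'a) set" assume "Q \<in> dyadic_subrectangles R"
  show "disjoint (dyadic_children Q)"
  proof (rule disjointI)
    fix X Y assume "X \<in> dyadic_children Q" "Y \<in> dyadic_children Q" "X \<noteq> Y"
    then obtain A B where
      A: "X = {x \<in> Q. \<forall>i. if i \<in> A then midpt Q i \<le> x $ i else x $ i < midpt Q i}" and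
      B: "Y = {x \<in> Q. \<forall>i. if i \<in> B then midpt Q i \<le> x $ i else x $ i < midpt Q i}"
      unfolding dyadic_children_def by blast
    have "A \<noteq> B" using A B \<open>X \<noteq> Y\<close> by blast
    then obtain i where "(i \<in> A) \<noteq> (i \<in> B)" by blast
    then show "X \<inter> Y = {}" unfolding A B by (auto dest!: spec[of _ i] split: if_splits)
  qed
qed (auto simp: countable_dyadic_subrectangles intro: dyadic_subrectangles.intros,
     auto simp: dyadic_children_def)

lemma dyadic_subrectangles_subset: "Q \<in> dyadic_subrectangles R \<Longrightarrow> Q \<subseteq> R"
  using set_tree.gen_subset[OF dyadic_set_tree dyadic_subrectangles.self]
  unfolding dyadic_subrectangles_gen by blast

lemma gen_dyadic_corners:
  assumes "has_corners R l u" "Q \<in> gen dyadic_children k R"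
  shows "\<exists>l' u'. has_corners Q l' u' \<and> (\<forall>i. u' $ i - l' $ i = (u $ i - l $ i) / 2 ^ k)"
  using assms(2)
proof (induction k arbitrary: Q)
  case 0 then show ?case using assms(1) by auto
next
  case (Suc k)
  then obtain P where P: "P \<in> gen dyadic_children k R" "Q \<in> dyadic_children P" by auto
  obtain l' u' where lu: "has_corners P l' u'" "\<And>i. u' $ i - l' $ i = (u $ i - l $ i) / 2 ^ k"
    using Suc.IH[OF P(1)] by blast
  show ?case using child_corners[OF lu(1) P(2)] lu(2) by (auto simp: mult.commute)
qed

lemma dyadic_cover: "x \<in> R \<Longrightarrow> \<exists>Q\<in>gen dyadic_children k R. x \<in> Q"
proof (induction k)
  case (Suc k)
  then obtain Q where "Q \<in> gen dyadic_children k R" "x \<in> Q" by blast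
  then show ?case using Union_dyadic_children[of Q] by auto blast
qed auto

text \<open>All sides halve in each generation, so the sum of the sides, which bounds the diameter,
  tends to 0. Hence every point of an open set has a dyadic rectangle around it inside that
  set.\<close>

lemma small_dyadic:
  fixes R :: "(real ^ 'n) set"
  assumes "R \<in> rectangles" "x \<in> R" "0 < e"
  shows "\<exists>k. \<exists>Q\<in>gen dyadic_children k R. x \<in> Q \<and> Q \<subseteq> ball x e"
proof -
  obtain l u where lu: "has_corners R l u" using rectangles_corners assms by blast
  define S where "S = (\<Sum>i\<in>UNIV. u $ i - l $ i)"
  have S: "S \<ge> 0" unfolding S_def using lu by (intro sum_nonneg) (auto simp: has_corners_def less_imp_le)
  obtain k where k: "S / e < 2 ^ k" using real_arch_pow[of 2 "S / e"] by auto
  obtain Q where Q: "Q \<in> gen dyadic_children k R" "x \<in> Q" using dyadic_cover assms by blast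
  obtain l' u' where lu': "has_corners Q l' u'" "\<And>i. u' $ i - l' $ i = (u $ i - l $ i) / 2 ^ k"
    using gen_dyadic_corners[OF lu Q(1)] by blast
  have "Q \<subseteq> ball x e"
  proof
    fix y assume "y \<in> Q"
    then have y: "\<And>i. l' $ i \<le> y $ i \<and> y $ i \<le> u' $ i" and x: "\<And>i. l' $ i \<le> x $ i \<and> x $ i \<le> u' $ i"
      using lu'(1) Q(2) by (auto simp: has_corners_def mem_box_cart subset_eq)
    have "dist x y \<le> (\<Sum>i\<in>UNIV. \<bar>(x - y) $ i\<bar>)" unfolding dist_norm by (rule norm_le_l1_cart)
    also have "\<dots> \<le> (\<Sum>i\<in>UNIV. (u $ i - l $ i) / 2 ^ k)"
    proof (rule sum_mono)
      fix i show "\<bar>(x - y) $ i\<bar> \<le> (u $ i - l $ i) / 2 ^ k"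
        using x[of i] y[of i] lu'(2)[of i] by (simp add: abs_le_iff)
    qed
    also have "\<dots> = S / 2 ^ k" by (simp add: S_def sum_divide_distrib)
    also have "\<dots> < e" using k assms(3) by (simp add: field_simps)
    finally show "y \<in> ball x e" by simp
  qed
  then show ?thesis using Q by blast
qed

section \<open>Measure, integrals and averages on rectangles\<close>

lemma rectangles_lmeasurable: "Q \<in> rectangles \<Longrightarrow> Q \<in> lmeasurable"
  using rectangles_corners corners_measurable(1) by blast

lemma rectangles_sets: "Q \<in> rectangles \<Longrightarrow> Q \<in> sets lebesgue"
  using rectangles_lmeasurable by blast

lemma rectangles_measure_pos: "Q \<in> rectangles \<Longrightarrow> 0 < measure lebesgue Q"
  using rectangles_corners corners_measurable(4) by blast

lemma rectangles_emeasure: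
  "Q \<in> rectangles \<Longrightarrow> emeasure lebesgue Q = ennreal (measure lebesgue Q)"
  by (rule emeasure_eq_measure2[OF rectangles_lmeasurable])

lemma child_measure:
  fixes Q :: "(real ^ 'n) set"
  assumes "Q \<in> rectangles" "Q' \<in> dyadic_children Q"
  shows "measure lebesgue Q = 2 ^ CARD('n) * measure lebesgue Q'"
proof -
  obtain l u where lu: "has_corners Q l u" using rectangles_corners assms by blast
  obtain l' u' where lu': "has_corners Q' l' u'" "\<And>i. u' $ i - l' $ i = (u $ i - l $ i) / 2"
    using child_corners[OF lu assms(2)] by blast
  show ?thesis unfolding corners_measurable(3)[OF lu] corners_measurable(3)[OF lu'(1)] lu'(2)
    by (simp add: prod_dividef)
qed

lemma set_nn_integral_eq_avg:
  assumes Q: "Q \<in> rectangles" and h: "set_integrable lebesgue Q h" and nn: "\<And>x. x \<in> Q \<Longrightarrow> 0 \<le> h x"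
  shows "(\<integral>\<^sup>+x\<in>Q. ennreal (h x) \<partial>lebesgue) = ennreal (avg Q h * measure lebesgue Q)"
proof -
  have "(\<integral>\<^sup>+x\<in>Q. ennreal (h x) \<partial>lebesgue) = (\<integral>\<^sup>+x. ennreal (indicator Q x *\<^sub>R h x) \<partial>lebesgue)"
    by (intro nn_integral_cong) (auto split: split_indicator)
  also have "\<dots> = ennreal (LINT x:Q|lebesgue. h x)"
    unfolding set_lebesgue_integral_def
    by (rule nn_integral_eq_integral) (use h nn in \<open>auto simp: set_integrable_def split: split_indicator\<close>)
  also have "(LINT x:Q|lebesgue. h x) = avg Q h * measure lebesgue Q"
    using rectangles_measure_pos[OF Q] by (simp add: avg_def)
  finally show ?thesis .
qed

lemma avg_nonneg:
  assumes "\<And>x. x \<in> Q \<Longrightarrow> 0 \<le> h x" shows "0 \<le> avg Q h"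
  unfolding avg_def set_lebesgue_integral_def using assms
  by (intro mult_nonneg_nonneg integral_nonneg_AE) (auto split: split_indicator)

lemma emeasure_density_indicator:
  fixes h :: "'a::euclidean_space \<Rightarrow> real"
  assumes h: "(\<lambda>x. indicator R x *\<^sub>R h x) \<in> borel_measurable lebesgue"
    and X: "X \<in> sets lebesgue" "X \<subseteq> R"
  shows "emeasure (density lebesgue (\<lambda>x. ennreal (indicator R x *\<^sub>R h x))) X
    = (\<integral>\<^sup>+x\<in>X. ennreal (h x) \<partial>lebesgue)"
  using X h by (subst emeasure_density) (auto intro!: nn_integral_cong split: split_indicator)

text \<open>One half of Lebesgue differentiation along dyadic rectangles, by a covering argument. If
  \<open>h > c + \<eta>\<close> on \<open>A\<close>, cover \<open>A\<close> by disjoint dyadic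
  rectangles inside an open \<open>U\<close> with |U - A| < \<tau>. Then (c + \<eta>) |A| \<le> c
  (|A| + \<tau>), and \<tau> tends to 0.\<close>

lemma dyadic_ae_le:
  fixes R :: "(real ^ 'n) set"
  assumes R: "R \<in> rectangles" and h: "set_integrable lebesgue R h" and nn: "\<And>x. x \<in> R \<Longrightarrow> 0 \<le> h x"
    and E: "E \<in> sets lebesgue" "E \<subseteq> R"
    and le: "\<And>Q. Q \<in> dyadic_subrectangles R \<Longrightarrow> Q \<inter> E \<noteq> {} \<Longrightarrow> avg Q h \<le> c" and c: "0 \<le> c"
  shows "AE x in lebesgue. x \<in> E \<longrightarrow> h x \<le> c"
proof -
  interpret set_tree "dyadic_subrectangles R" dyadic_children by (rule dyadic_set_tree)
  have hm: "(\<lambda>x. indicator R x *\<^sub>R h x) \<in> borel_measurable lebesgue"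
    using h unfolding set_integrable_def by blast
  define \<nu> where "\<nu> = density lebesgue (\<lambda>x. ennreal (indicator R x *\<^sub>R h x))"
  have \<nu>: "emeasure \<nu> X = (\<integral>\<^sup>+x\<in>X. ennreal (h x) \<partial>lebesgue)" if "X \<in> sets lebesgue" "X \<subseteq> R" for X
    unfolding \<nu>_def by (rule emeasure_density_indicator[OF hm that])
  have null: "{x \<in> E. c + \<eta> < h x} \<in> null_sets lebesgue" if \<eta>: "0 < \<eta>" for \<eta>
  proof -
    define A where "A = {x \<in> E. c + \<eta> < h x}"
    have AR: "A \<subseteq> R" using E A_def by blast
    have "A = E \<inter> {x \<in> space lebesgue. c + \<eta> < indicator R x *\<^sub>R h x}"
      using E(2) by (auto simp: A_def)
    also have "\<dots> \<in> sets lebesgue" using E(1) hm by measurable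
    finally have A: "A \<in> sets lebesgue" .
    have "A \<in> lmeasurable"
      by (rule fmeasurableI2[OF rectangles_lmeasurable[OF R] AR A])
    then have Am: "emeasure lebesgue A = ennreal (measure lebesgue A)" by (rule emeasure_eq_measure2)
    have "\<eta> * measure lebesgue A \<le> c * \<tau>" if \<tau>: "0 < \<tau>" for \<tau>
    proof -
      obtain U where U: "open U" "A \<subseteq> U" "U - A \<in> lmeasurable" "emeasure lebesgue (U - A) < ennreal \<tau>"
        using sets_lebesgue_outer_open[OF A \<tau>] by blast
      \<comment> \<open>Only rectangles meeting \<open>A\<close> are selected, because the averages
        are controlled on rectangles meeting \<open>E\<close>.\<close>
      define V where "V = first R (\<lambda>j Q. Q \<subseteq> U \<and> Q \<inter> A \<noteq> {})"
      have VD: "V \<subseteq> dyadic_subrectangles R"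
        unfolding V_def by (rule first_nodes[OF dyadic_subrectangles.self])
      have Vr: "Q \<in> rectangles" "Q \<subseteq> R" if "Q \<in> V" for Q
        using VD that R dyadic_subrectangles_rectangles dyadic_subrectangles_subset by blast+
      have AV: "A \<subseteq> \<Union>V"
      proof
        fix x assume x: "x \<in> A"
        then obtain e where "0 < e" "ball x e \<subseteq> U" using U openE by blast
        then obtain k Q where "Q \<in> gen dyadic_children k R" "x \<in> Q" "Q \<subseteq> U"
          using small_dyadic[OF R] x AR by (meson subset_eq)
        then show "x \<in> \<Union>V" unfolding V_def Union_first using x by blast
      qed
      have VU: "\<Union>V \<subseteq> U" by (auto simp: V_def first_def)
      have VR: "\<Union>V \<subseteq> R" using Vr by blast
      have cV: "countable V" "disjoint V" unfolding V_def
        by (simp_all add: countable_first first_disjoint dyadic_subrectangles.self)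
      have Vs: "\<Union>V \<in> sets lebesgue" using cV Vr rectangles_sets by (intro sets.countable_Union) auto
      have "ennreal (c + \<eta>) * emeasure lebesgue A \<le> emeasure \<nu> A"
      proof -
        have "ennreal (c + \<eta>) * emeasure lebesgue A = (\<integral>\<^sup>+x. ennreal (c + \<eta>) * indicator A x \<partial>lebesgue)"
          using A by (simp add: nn_integral_cmult_indicator)
        also have "\<dots> \<le> (\<integral>\<^sup>+x\<in>A. ennreal (h x) \<partial>lebesgue)"
          by (intro nn_integral_mono) (auto simp: A_def ennreal_leI split: split_indicator)
        finally show ?thesis using \<nu>[OF A AR] by simp
      qed
      also have "\<dots> \<le> emeasure \<nu> (\<Union>V)"
        using AV Vs by (intro emeasure_mono) (auto simp: \<nu>_def)
      also have "\<dots> \<le> ennreal c * emeasure lebesgue (\<Union>V)"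
      proof -
        have "emeasure \<nu> (\<Union>Q\<in>V. Q) \<le> ennreal c * emeasure lebesgue (\<Union>V)"
        proof (rule emeasure_Union_le_family)
          fix Q assume Q: "Q \<in> V"
          then obtain "Q \<in> dyadic_subrectangles R" "Q \<inter> A \<noteq> {}"
            using VD by (auto simp: V_def first_def)
          then have "avg Q h \<le> c" using le[of Q] by (auto simp: A_def)
          then have "avg Q h * measure lebesgue Q \<le> c * measure lebesgue Q" by (simp add: mult_right_mono)
          moreover have "emeasure \<nu> Q = ennreal (avg Q h * measure lebesgue Q)"
            using \<nu>[of Q] Vr[OF Q] rectangles_sets h nn
            by (subst set_nn_integral_eq_avg[symmetric]) (auto intro: set_integrable_subset)
          ultimately show "emeasure \<nu> Q \<le> ennreal c * emeasure lebesgue Q"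
            using c Vr[OF Q] by (simp add: rectangles_emeasure ennreal_mult'[symmetric] ennreal_leI)
          show "Q \<in> sets \<nu>" using Vr[OF Q] rectangles_sets by (simp add: \<nu>_def)
        qed (use cV Vr rectangles_sets in auto)
        then show ?thesis by simp
      qed
      also have "\<dots> \<le> ennreal c * (emeasure lebesgue A + ennreal \<tau>)"
      proof -
        have "emeasure lebesgue (\<Union>V) \<le> emeasure lebesgue (A \<union> (U - A))"
          using VU A fmeasurableD[OF U(3)] by (intro emeasure_mono sets.Un) auto
        also have "\<dots> \<le> emeasure lebesgue A + emeasure lebesgue (U - A)"
          using A U(3) by (intro emeasure_subadditive) auto
        also have "\<dots> \<le> emeasure lebesgue A + ennreal \<tau>"
          using U(4) by (intro add_left_mono less_imp_le)
        finally show ?thesis by (rule mult_left_mono) simp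
      qed
      finally have "ennreal ((c + \<eta>) * measure lebesgue A) \<le> ennreal (c * (measure lebesgue A + \<tau>))"
        unfolding Am using c \<eta> \<tau> by (simp add: ennreal_mult' ennreal_plus[symmetric] del: ennreal_plus)
      then have "(c + \<eta>) * measure lebesgue A \<le> c * (measure lebesgue A + \<tau>)"
        using c \<tau> by (subst (asm) ennreal_le_iff) auto
      then show ?thesis by (simp add: algebra_simps)
    qed
    then have "\<eta> * measure lebesgue A \<le> 0"
    proof -
      assume *: "\<And>\<tau>. 0 < \<tau> \<Longrightarrow> \<eta> * measure lebesgue A \<le> c * \<tau>"
      show ?thesis
      proof (rule field_le_epsilon)
        fix e :: real assume e: "0 < e"
        \<comment> \<open>The denominator \<open>c + 1\<close> covers \<open>c = 0\<close>.\<close>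
        have "\<eta> * measure lebesgue A \<le> c * (e / (c + 1))" using c e by (intro *) simp
        also have "\<dots> \<le> e" using c e by (simp add: field_simps)
        finally show "\<eta> * measure lebesgue A \<le> 0 + e" by simp
      qed
    qed
    then have "measure lebesgue A = 0" using \<eta> by (simp add: mult_le_0_iff antisym)
    then show ?thesis using A Am unfolding A_def[symmetric] by (auto simp: null_sets_def)
  qed
  have "AE x in lebesgue. \<forall>n. x \<notin> {x \<in> E. c + 1 / Suc n < h x}"
    unfolding AE_all_countable by (intro allI AE_not_in null) simp
  then show ?thesis
  proof (rule AE_mp, intro AE_I2 impI)
    fix x assume x: "\<forall>n. x \<notin> {x \<in> E. c + 1 / Suc n < h x}" "x \<in> E"
    have "(\<lambda>n. c + 1 / Suc n) \<longlonglongrightarrow> c + 0"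
      by (intro tendsto_intros LIMSEQ_inverse_real_of_nat[unfolded inverse_eq_divide])
    then have "h x \<le> c + 0" by (rule LIMSEQ_le_const) (use x in \<open>auto simp: not_less\<close>)
    then show "h x \<le> c" by simp
  qed
qed

text \<open>\<open>V\<close> consists of the maximal dyadic rectangles with average above
  \<open>c\<close>. The root is not among them, so each has a parent with average at most
  \<open>c\<close> and 2^n times its measure: hence the bound 2^n c. Points outside \<open>V\<close>
  lie only in rectangles with average at most \<open>c\<close>, so \<open>dyadic_ae_le\<close>
  applies to them.\<close>

lemma calderon_zygmund:
  fixes R :: "(real ^ 'n) set"
  assumes R: "R \<in> rectangles" and h: "set_integrable lebesgue R h" and nn: "\<And>x. x \<in> R \<Longrightarrow> 0 \<le> h x"
    and c: "avg R h < c"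
  shows "\<exists>V. V \<subseteq> dyadic_subrectangles R \<and> disjoint V
    \<and> (\<forall>Q\<in>V. avg Q h \<le> 2 ^ CARD('n) * c)
    \<and> ennreal c * emeasure lebesgue (\<Union>V) \<le> ennreal (avg R h * measure lebesgue R)
    \<and> (AE x in lebesgue. x \<in> R - \<Union>V \<longrightarrow> h x \<le> c)"
proof -
  interpret set_tree "dyadic_subrectangles R" dyadic_children by (rule dyadic_set_tree)
  have c0: "0 < c" using avg_nonneg[of R h] nn c by fastforce
  have hm: "(\<lambda>x. indicator R x *\<^sub>R h x) \<in> borel_measurable lebesgue"
    using h unfolding set_integrable_def by blast
  define \<nu> where "\<nu> = density lebesgue (\<lambda>x. ennreal (indicator R x *\<^sub>R h x))"
  have \<nu>: "emeasure \<nu> Q = ennreal (avg Q h * measure lebesgue Q)" "Q \<in> rectangles" "Q \<subseteq> R"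
    if "Q \<in> dyadic_subrectangles R" for Q
  proof -
    show Q: "Q \<in> rectangles" "Q \<subseteq> R"
      using that R dyadic_subrectangles_rectangles dyadic_subrectangles_subset by blast+
    show "emeasure \<nu> Q = ennreal (avg Q h * measure lebesgue Q)"
      using Q h nn rectangles_sets unfolding \<nu>_def
      by (subst emeasure_density_indicator[OF hm])
         (auto intro!: set_nn_integral_eq_avg intro: set_integrable_subset)
  qed
  define V where "V = first R (\<lambda>j Q. c < avg Q h)"
  have VD: "V \<subseteq> dyadic_subrectangles R"
    unfolding V_def by (rule first_nodes[OF dyadic_subrectangles.self])
  have cV: "countable V" "disjoint V" unfolding V_def
    by (simp_all add: countable_first first_disjoint dyadic_subrectangles.self)
  have Vs: "\<Union>V \<in> sets lebesgue"
    using cV VD \<nu>(2) rectangles_sets by (intro sets.countable_Union) auto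
  have "avg Q h \<le> 2 ^ CARD('n) * c" if QV: "Q \<in> V" for Q
  proof -
    obtain j where j: "Q \<in> gen dyadic_children j R" "c < avg Q h"
      "\<And>i Q'. i < j \<Longrightarrow> Q' \<in> gen dyadic_children i R \<Longrightarrow> Q \<subseteq> Q' \<Longrightarrow> \<not> c < avg Q' h"
      using QV unfolding V_def first_def by blast
    have "j \<noteq> 0" using j c by (cases j) auto
    then obtain i where i: "j = Suc i" using not0_implies_Suc by blast
    then obtain P where P: "P \<in> gen dyadic_children i R" "Q \<in> dyadic_children P" using j by auto
    have PD: "P \<in> dyadic_subrectangles R" "Q \<in> dyadic_subrectangles R"
      using P(1) VD QV unfolding dyadic_subrectangles_gen by blast+
    have QP: "Q \<subseteq> P" using children_subset PD(1) P(2) by blast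
    have "avg P h \<le> c" using j(3)[of i P] i P QP by simp
    \<comment> \<open>Integrals are compared, since averages are not monotone under
      inclusion.\<close>
    have "ennreal (avg Q h * measure lebesgue Q) \<le> ennreal (avg P h * measure lebesgue P)"
      unfolding \<nu>(1)[OF PD(1), symmetric] \<nu>(1)[OF PD(2), symmetric]
      using QP \<nu>(2)[OF PD(1)] rectangles_sets by (intro emeasure_mono) (auto simp: \<nu>_def)
    moreover have "0 \<le> avg P h" using nn \<nu>(3)[OF PD(1)] by (intro avg_nonneg) auto
    ultimately have "avg Q h * measure lebesgue Q \<le> avg P h * measure lebesgue P"
      by (subst (asm) ennreal_le_iff) auto
    also have "\<dots> \<le> c * (2 ^ CARD('n) * measure lebesgue Q)"
      using child_measure[OF \<nu>(2)[OF PD(1)] P(2)] \<open>avg P h \<le> c\<close> by (simp add: mult_right_mono)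
    finally show ?thesis using rectangles_measure_pos[OF \<nu>(2)[OF PD(2)]] by (simp add: mult.assoc[symmetric] mult.commute)
  qed
  moreover have "ennreal c * emeasure lebesgue (\<Union>V) \<le> ennreal (avg R h * measure lebesgue R)"
  proof -
    have "emeasure lebesgue (\<Union>Q\<in>V. Q) \<le> ennreal (1 / c) * emeasure \<nu> (\<Union>V)"
    proof (rule emeasure_Union_le_family)
      fix Q assume Q: "Q \<in> V"
      then have QD: "Q \<in> dyadic_subrectangles R" using VD by blast
      have "c < avg Q h" using Q by (auto simp: V_def first_def)
      then have "measure lebesgue Q \<le> 1 / c * (avg Q h * measure lebesgue Q)"
        using c0 by (simp add: field_simps mult_right_mono)
      then show "emeasure lebesgue Q \<le> ennreal (1 / c) * emeasure \<nu> Q"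
        using \<nu>[OF QD] c0 rectangles_emeasure[of Q] ennreal_leI
        by (simp add: ennreal_mult'[symmetric])
      show "Q \<in> sets lebesgue" using \<nu>(2)[OF QD] rectangles_sets by blast
    qed (use cV VD \<nu>(2) rectangles_sets in \<open>auto simp: \<nu>_def\<close>)
    also have "\<dots> \<le> ennreal (1 / c) * emeasure \<nu> R"
      using VD \<nu>(3) R rectangles_sets
      by (intro mult_left_mono emeasure_mono) (auto simp: \<nu>_def)
    finally have "ennreal c * emeasure lebesgue (\<Union>V) \<le> ennreal c * (ennreal (1 / c) * emeasure \<nu> R)"
      by (intro mult_left_mono) auto
    also have "\<dots> = emeasure \<nu> R"
      using c0 by (simp add: mult.assoc[symmetric] ennreal_mult'[symmetric])
    also have "\<dots> = ennreal (avg R h * measure lebesgue R)"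
      by (rule \<nu>(1)) (rule dyadic_subrectangles.self)
    finally show ?thesis .
  qed
  moreover have "AE x in lebesgue. x \<in> R - \<Union>V \<longrightarrow> h x \<le> c"
  proof (rule dyadic_ae_le[OF R h nn])
    show "R - \<Union>V \<in> sets lebesgue" using Vs R rectangles_sets by blast
    fix Q assume "Q \<in> dyadic_subrectangles R" and ne: "Q \<inter> (R - \<Union>V) \<noteq> {}"
    then obtain k where "Q \<in> gen dyadic_children k R" unfolding dyadic_subrectangles_gen by (elim UN_E)
    moreover obtain x where x: "x \<in> Q" "x \<notin> \<Union>V" using ne by blast
    ultimately have "\<not> c < avg Q h"
      using UnionI[of Q "{Q. \<exists>j. Q \<in> gen dyadic_children j R \<and> c < avg Q h}" x]
      unfolding V_def Union_first by (metis (mono_tags, lifting) CollectI)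
    then show "avg Q h \<le> c" by simp
  qed (use c0 in auto)
  ultimately show ?thesis using VD cV by blast
qed

section \<open>Polynomials and the projection\<close>

definition monomial :: "('n \<Rightarrow> nat) \<Rightarrow> real ^ 'n \<Rightarrow> real" where
  "monomial k x = (\<Prod>i\<in>UNIV. (x $ i) ^ k i)"

lemma polys_monomial: "polys m = {(\<lambda>x. \<Sum>k | sum k UNIV \<le> m. c k * monomial k x) | c. True}"
  by (simp add: polys_def monomial_def)

lemma finite_multi_indices: "finite {k :: 'n::finite \<Rightarrow> nat. sum k UNIV \<le> m}"
proof (rule finite_subset)
  show "{k :: 'n \<Rightarrow> nat. sum k UNIV \<le> m} \<subseteq> PiE UNIV (\<lambda>_. {..m})"
    by (auto simp: PiE_def) (metis finite iso_tuple_UNIV_I le_trans member_le_sum zero_le)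
qed (auto intro: finite_PiE)

lemma polysI: "p = (\<lambda>x. \<Sum>k | sum k UNIV \<le> m. c k * monomial k x) \<Longrightarrow> p \<in> polys m"
  unfolding polys_monomial by blast

lemma polysE:
  assumes "p \<in> polys m"
  obtains c where "p = (\<lambda>x. \<Sum>k | sum k UNIV \<le> m. c k * monomial k x)"
  using assms unfolding polys_monomial by auto

lemma monomial_in_polys: "sum k UNIV \<le> m \<Longrightarrow> monomial k \<in> polys m"
proof (rule polysI[where c = "\<lambda>j. if j = k then 1 else 0"])
  assume k: "sum k UNIV \<le> m"
  have "(\<Sum>j | sum j UNIV \<le> m. (if j = k then 1 else 0) * monomial j x)
    = (\<Sum>j | sum j UNIV \<le> m. if j = k then monomial k x else 0)" for x :: "real ^ 'a"
    by (rule sum.cong) auto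
  then show "monomial k = (\<lambda>x. \<Sum>j | sum j UNIV \<le> m. (if j = k then 1 else 0) * monomial j x)"
    using k by (simp add: sum.delta[OF finite_multi_indices])
qed

lemma polys_zero: "(\<lambda>x. 0) \<in> polys m"
  by (rule polysI[where c = "\<lambda>_. 0"]) simp

lemma polys_lin:
  assumes "p \<in> polys m" "q \<in> polys m" shows "(\<lambda>x. a * p x + b * q x) \<in> polys m"
proof -
  obtain c where c: "p = (\<lambda>x. \<Sum>k | sum k UNIV \<le> m. c k * monomial k x)" using assms(1) polysE by blast
  obtain d where d: "q = (\<lambda>x. \<Sum>k | sum k UNIV \<le> m. d k * monomial k x)" using assms(2) polysE by blast
  show ?thesis
    by (rule polysI[where c = "\<lambda>k. a * c k + b * d k"])
       (simp add: c d sum_distrib_left algebra_simps sum.distrib)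
qed

lemma polys_add: "p \<in> polys m \<Longrightarrow> q \<in> polys m \<Longrightarrow> (\<lambda>x. p x + q x) \<in> polys m"
  using polys_lin[of p m q 1 1] by simp

lemma polys_diff: "p \<in> polys m \<Longrightarrow> q \<in> polys m \<Longrightarrow> (\<lambda>x. p x - q x) \<in> polys m"
  using polys_lin[of p m q 1 "-1"] by simp

lemma polys_cmult: "p \<in> polys m \<Longrightarrow> (\<lambda>x. a * p x) \<in> polys m"
  using polys_lin[of p m p a 0] by simp

lemma polys_sum:
  assumes "\<And>i. i \<in> I \<Longrightarrow> f i \<in> polys m" shows "(\<lambda>x. \<Sum>i\<in>I. f i x) \<in> polys m"
  using assms by (induction I rule: infinite_finite_induct) (auto intro: polys_zero polys_add)

lemma polys_mult:
  assumes "p \<in> polys a" "q \<in> polys b" shows "(\<lambda>x. p x * q x) \<in> polys (a + b)"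
proof -
  obtain c where c: "p = (\<lambda>x. \<Sum>k | sum k UNIV \<le> a. c k * monomial k x)" using assms(1) polysE by blast
  obtain d where d: "q = (\<lambda>x. \<Sum>k | sum k UNIV \<le> b. d k * monomial k x)" using assms(2) polysE by blast
  have eq: "(\<lambda>x. p x * q x) = (\<lambda>x. \<Sum>k | sum k UNIV \<le> a. \<Sum>j | sum j UNIV \<le> b.
      (c k * d j) * monomial (\<lambda>i. k i + j i) x)"
    by (simp add: c d sum_product monomial_def power_add prod.distrib algebra_simps)
  show ?thesis unfolding eq
    by (intro polys_sum polys_cmult monomial_in_polys) (auto simp: sum.distrib intro: add_mono)
qed

lemma polys_const: "(\<lambda>x. a) \<in> polys 0"
  using polys_cmult[OF monomial_in_polys[of "\<lambda>_. 0" 0], of a] by (simp add: monomial_def)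

lemma polys_mono: "p \<in> polys a \<Longrightarrow> a \<le> b \<Longrightarrow> p \<in> polys b"
  by (elim polysE, hypsubst, intro polys_sum polys_cmult monomial_in_polys) auto

lemma polys_coord: "(\<lambda>x. x $ i) \<in> polys 1"
proof -
  have "monomial (\<lambda>j. if j = i then 1 else 0) x = x $ i" for x :: "real ^ 'a"
  proof -
    have "monomial (\<lambda>j. if j = i then 1 else 0) x = (\<Prod>j\<in>UNIV. if j = i then x $ j else 1)"
      unfolding monomial_def by (rule prod.cong) auto
    then show ?thesis by simp
  qed
  then have "monomial (\<lambda>j. if j = i then 1 else 0) = (\<lambda>x. x $ i)" by blast
  moreover have "monomial (\<lambda>j. if j = i then 1 else 0 :: nat) \<in> (polys 1 :: (real ^ 'a \<Rightarrow> real) set)"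
    by (rule monomial_in_polys) simp
  ultimately show ?thesis by simp
qed

lemma polys_power: "p \<in> polys a \<Longrightarrow> (\<lambda>x. p x ^ k) \<in> polys (k * a)"
proof (induction k)
  case 0 then show ?case using polys_const[of 1] by simp
next
  case (Suc k) then show ?case using polys_mult[of p a "\<lambda>x. p x ^ k" "k * a"] by simp
qed

lemma polys_prod:
  assumes "finite I" "\<And>i. i \<in> I \<Longrightarrow> f i \<in> polys (d i)"
  shows "(\<lambda>x. \<Prod>i\<in>I. f i x) \<in> polys (sum d I)"
  using assms
proof (induction I)
  case empty then show ?case using polys_const[of 1] by simp
next
  case (insert i I) then show ?case using polys_mult[of "f i" "d i"] by auto
qed

text \<open>These maps carry the unit cube to rectangles. The degree is kept because each factor of
  a monomial has degree at most \<open>k i\<close> in the new variables.\<close>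

lemma polys_affine:
  fixes q :: "real ^ 'n \<Rightarrow> real"
  assumes "q \<in> polys m" shows "(\<lambda>y. q (\<chi> i. l i + s i * y $ i)) \<in> polys m"
proof -
  obtain c where c: "q = (\<lambda>x. \<Sum>k | sum k UNIV \<le> m. c k * monomial k x)" using assms polysE by blast
  have "(\<lambda>y. monomial k (\<chi> i. l i + s i * y $ i)) \<in> (polys m :: (real ^ 'n \<Rightarrow> real) set)"
    if "sum k UNIV \<le> m" for k
  proof -
    have "(\<lambda>y :: real ^ 'n. l i + s i * y $ i) \<in> polys 1" for i
      by (intro polys_add polys_cmult polys_coord polys_mono[OF polys_const]) simp
    then have "(\<lambda>y :: real ^ 'n. (l i + s i * y $ i) ^ k i) \<in> polys (k i)" for i
      using polys_power[of _ 1] by fastforce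
    then show ?thesis unfolding monomial_def
      using polys_prod[of UNIV "\<lambda>i (y :: real ^ 'n). (l i + s i * y $ i) ^ k i" k] polys_mono that by auto
  qed
  then show ?thesis unfolding c by (intro polys_sum polys_cmult) auto
qed

lemma polys_continuous: "q \<in> polys m \<Longrightarrow> continuous_on S q"
  by (elim polysE) (auto simp: monomial_def intro!: continuous_intros)

lemma polys_on_line:
  assumes "q \<in> polys m" shows "\<exists>P :: real poly. \<forall>t. q (x + t *\<^sub>R (y - x)) = poly P t"
proof -
  obtain c where c: "q = (\<lambda>x. \<Sum>k | sum k UNIV \<le> m. c k * monomial k x)" using assms polysE by blast
  show ?thesis
    by (rule exI[of _ "\<Sum>k | sum k UNIV \<le> m. smult (c k) (\<Prod>i\<in>UNIV. [:x $ i, (y - x) $ i:] ^ k i)"])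
       (simp add: c monomial_def poly_sum poly_prod)
qed

text \<open>On the line through \<open>x\<close> and \<open>y\<close> the polynomial is univariate
  and vanishes at infinitely many parameters. An identity on the whole space is wanted because
  \<open>orthonormal_basis\<close> compares functions everywhere, not only on the rectangle.\<close>

lemma polys_vanish:
  assumes q: "q \<in> polys m" and U: "open U" "x \<in> U" and z: "\<And>x. x \<in> U \<Longrightarrow> q x = 0"
  shows "q y = 0"
proof -
  obtain P where P: "\<And>t. q (x + t *\<^sub>R (y - x)) = poly P t" using polys_on_line[OF q] by blast
  have "open ((\<lambda>t. x + t *\<^sub>R (y - x)) -` U)"
    using U(1) by (intro open_vimage continuous_intros) auto
  moreover have "0 \<in> (\<lambda>t. x + t *\<^sub>R (y - x)) -` U" using U(2) by simp
  ultimately have "infinite ((\<lambda>t. x + t *\<^sub>R (y - x)) -` U)"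
    by (metis empty_iff finite_imp_not_open)
  moreover have "(\<lambda>t. x + t *\<^sub>R (y - x)) -` U \<subseteq> {t. poly P t = 0}" using z by (auto simp flip: P)
  ultimately have "P = 0" using poly_roots_finite finite_subset by metis
  then show ?thesis using P[of 1] by simp
qed

section \<open>Averages and their invariance under affine maps\<close>

lemma set_integrable_continuous_rectangle:
  fixes g :: "real ^ 'n \<Rightarrow> real"
  assumes "Q \<in> rectangles" "continuous_on UNIV g" shows "set_integrable lebesgue Q g"
proof -
  obtain l u where "has_corners Q l u" using rectangles_corners assms by blast
  then have "Q \<subseteq> cbox l u" by (simp add: has_corners_def)
  moreover have "set_integrable lebesgue (cbox l u) g"
    by (intro absolutely_integrable_continuous continuous_on_subset[OF assms(2)]) simp
  ultimately show ?thesis using rectangles_sets[OF assms(1)] by (auto intro: set_integrable_subset)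
qed

lemma set_integrable_mult_continuous:
  assumes "Q \<in> rectangles" "continuous_on UNIV g" "set_integrable lebesgue Q f"
  shows "set_integrable lebesgue Q (\<lambda>x. f x * g x :: real)"
proof -
  obtain l u where "has_corners Q l u" using rectangles_corners assms by blast
  then have sub: "Q \<subseteq> cbox l u" by (simp add: has_corners_def)
  have "compact (g ` cbox l u)"
    by (intro compact_continuous_image continuous_on_subset[OF assms(2)]) auto
  then have "bounded (g ` Q)" using sub by (meson bounded_subset compact_imp_bounded image_mono)
  then have "set_integrable lebesgue Q (\<lambda>x. g x * f x)"
    using assms(3) rectangles_sets[OF assms(1)]
    by (intro absolutely_integrable_bounded_measurable_product[OF bilinear_times]
        continuous_imp_measurable_on_sets_lebesgue continuous_on_subset[OF assms(2)]) auto
  then show ?thesis by (simp add: mult.commute)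
qed

lemma avg_add:
  "set_integrable lebesgue Q f \<Longrightarrow> set_integrable lebesgue Q g \<Longrightarrow>
    avg Q (\<lambda>x. f x + g x) = avg Q f + avg Q g"
  by (simp add: avg_def distrib_left)

lemma avg_diff:
  "set_integrable lebesgue Q f \<Longrightarrow> set_integrable lebesgue Q g \<Longrightarrow>
    avg Q (\<lambda>x. f x - g x) = avg Q f - avg Q g"
  by (simp add: avg_def right_diff_distrib)

lemma avg_cmult: "avg Q (\<lambda>x. a * f x) = a * avg Q f"
  by (simp add: avg_def)

lemma avg_mono:
  assumes "set_integrable lebesgue Q f" "set_integrable lebesgue Q g" "\<And>x. x \<in> Q \<Longrightarrow> f x \<le> g x"
  shows "avg Q f \<le> avg Q g"
  unfolding avg_def using assms by (intro mult_left_mono set_integral_mono) auto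

lemma abs_avg_le:
  assumes "set_integrable lebesgue Q f" shows "\<bar>avg Q f\<bar> \<le> avg Q (\<lambda>x. \<bar>f x\<bar>)"
  using set_integral_norm_bound[OF assms] by (simp add: avg_def abs_mult divide_right_mono)

lemma avg_sum:
  assumes "\<And>i. i \<in> I \<Longrightarrow> set_integrable lebesgue Q (f i)"
  shows "avg Q (\<lambda>x. \<Sum>i\<in>I. f i x) = (\<Sum>i\<in>I. avg Q (f i))"
proof -
  \<comment> \<open>Integrability of the partial sums has to be carried through the
    induction.\<close>
  have "set_integrable lebesgue Q (\<lambda>x. \<Sum>i\<in>I. f i x) \<and> ?thesis"
    using assms
  proof (induction I rule: infinite_finite_induct)
    case (insert i I)
    then show ?case using avg_add[of Q "f i" "\<lambda>x. \<Sum>i\<in>I. f i x"] by auto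
  qed (auto simp: avg_def set_integrable_def)
  then show ?thesis by blast
qed

lemma avg_eq_integral:
  assumes Q: "has_corners Q l u" and g: "continuous_on UNIV g"
  shows "avg Q g = integral (cbox l u) g / (\<Prod>i\<in>UNIV. u $ i - l $ i)"
proof -
  have R: "Q \<in> rectangles" "Q \<subseteq> cbox l u" using Q by (auto simp: has_corners_def)
  have gQ: "set_integrable lebesgue Q g" by (rule set_integrable_continuous_rectangle[OF R(1) g])
  have gc: "set_integrable lebesgue (cbox l u) g"
    by (intro absolutely_integrable_continuous continuous_on_subset[OF g]) simp
  have "(LINT x:Q|lebesgue. g x) = integral Q g" by (rule set_lebesgue_integral_eq_integral(2)[OF gQ])
  also have "\<dots> = integral (cbox l u) g"
    using corners_measurable(2)[OF Q] R(2)
    by (intro integral_spike_set) (auto intro: negligible_subset)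
  finally show ?thesis using corners_measurable(3)[OF Q] by (simp add: avg_def)
qed

text \<open>A translation followed by a stretch of each axis. Averages absorb the Jacobian, which is
  why one constant on the unit cube serves for all rectangles, however eccentric.\<close>

lemma avg_scale:
  fixes Q :: "(real ^ 'n) set"
  assumes Q: "has_corners Q l u" and g: "continuous_on UNIV g"
  shows "avg Q g = integral (cbox 0 1) (\<lambda>y. g (\<chi> i. l $ i + (u $ i - l $ i) * y $ i))"
proof -
  have lu: "\<And>i. l $ i < u $ i" using Q by (auto simp: has_corners_def)
  define s where "s i = u $ i - l $ i" for i
  have s: "0 < s i" for i using lu by (simp add: s_def)
  have "(g has_integral integral (cbox l u) g) (cbox l u)"
    by (intro integrable_integral integrable_continuous continuous_on_subset[OF g]) simp
  from has_integral_affinity[OF this, of 1 l]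
  have "((\<lambda>x. g (x + l)) has_integral integral (cbox l u) g) ((\<lambda>x. x - l) ` cbox l u)" by simp
  moreover have "(\<lambda>x. x - l) ` cbox l u = cbox 0 (u - l)"
    using cbox_translation[of "-l" l u] by (simp add: image_def algebra_simps)
  ultimately have "((\<lambda>x. g (x + l)) has_integral integral (cbox l u) g) (cbox 0 (u - l))" by simp
  from has_integral_stretch_cart[OF this, of s]
  have "((\<lambda>x. g ((\<chi> k. s k * x $ k) + l)) has_integral integral (cbox l u) g /\<^sub>R \<bar>prod s UNIV\<bar>)
    ((\<lambda>x. \<chi> k. x $ k / s k) ` cbox 0 (u - l))" using s by (simp add: less_imp_neq[symmetric])
  moreover have "(\<lambda>x. \<chi> k. x $ k / s k) ` cbox 0 (u - l) = cbox 0 1"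
  proof (intro equalityI subsetI)
    fix x assume "x \<in> (\<lambda>x. \<chi> k. x $ k / s k) ` cbox 0 (u - l)"
    then show "x \<in> cbox 0 1" using s by (auto simp: mem_box_cart s_def less_imp_le)
  next
    fix x :: "real ^ 'n" assume x: "x \<in> cbox 0 1"
    have "(\<chi> k. s k * x $ k) \<in> cbox 0 (u - l)"
      using x s by (auto simp: mem_box_cart s_def mult_left_le less_imp_le)
    moreover have "x = (\<chi> k. (\<chi> k. s k * x $ k) $ k / s k)"
      using s by (simp add: vec_eq_iff less_imp_neq[symmetric])
    ultimately show "x \<in> (\<lambda>x. \<chi> k. x $ k / s k) ` cbox 0 (u - l)" by blast
  qed
  moreover have "(\<chi> k. s k * x $ k) + l = (\<chi> i. l $ i + (u $ i - l $ i) * x $ i)" for x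
    by (simp add: vec_eq_iff s_def)
  ultimately have "integral (cbox 0 1) (\<lambda>y. g (\<chi> i. l $ i + (u $ i - l $ i) * y $ i))
    = integral (cbox l u) g /\<^sub>R \<bar>prod s UNIV\<bar>"
    by (simp add: integral_unique)
  also have "\<bar>prod s UNIV\<bar> = prod s UNIV" using s by (simp add: prod_nonneg less_imp_le)
  finally show ?thesis unfolding avg_eq_integral[OF Q g] by (simp add: s_def divide_inverse mult.commute)
qed

lemma unit_cube_corners: "has_corners (cbox 0 1 :: (real ^ 'n) set) 0 1"
proof -
  have "(cbox 0 1 :: (real ^ 'n) set) = {x. \<forall>i. x $ i \<in> (\<lambda>_. {0..1}) i}"
    by (auto simp: mem_box_cart)
  moreover have "is_interval {0..1::real} \<and> bounded {0..1::real} \<and> interior {0..1::real} \<noteq> {}"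
    by (simp add: is_interval_cc)
  ultimately have "(cbox 0 1 :: (real ^ 'n) set) \<in> rectangles" unfolding rectangles_def
    by (intro CollectI exI[of _ "\<lambda>_. {0..1}"] conjI) auto
  then show ?thesis by (auto simp: has_corners_def box_subset_cbox)
qed

section \<open>The inner product given by averages, and orthonormal bases\<close>

lemma avg_square_zero:
  assumes Q: "Q \<in> rectangles" and q: "q \<in> polys m" and z: "avg Q (\<lambda>x. q x * q x) = 0"
  shows "q = (\<lambda>x. 0)"
proof -
  obtain l u where lu: "has_corners Q l u" using rectangles_corners Q by blast
  have l: "\<And>i. l $ i < u $ i" using lu by (simp add: has_corners_def)
  have ne: "box l u \<noteq> {}" using l by (simp add: interval_ne_empty_cart)
  have cont: "continuous_on S (\<lambda>x. q x * q x)" for S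
    using polys_continuous[OF q] by (intro continuous_intros)
  have "(\<Prod>i\<in>UNIV. u $ i - l $ i) \<noteq> 0" using l by (simp add: less_imp_neq[symmetric])
  then have "integral (cbox l u) (\<lambda>x. q x * q x) = 0"
    using z avg_eq_integral[OF lu cont] by simp
  moreover have "((\<lambda>x. q x * q x) has_integral integral (cbox l u) (\<lambda>x. q x * q x)) (cbox l u)"
    by (intro integrable_integral integrable_continuous cont)
  ultimately have "((\<lambda>x. q x * q x) has_integral 0) (cbox l u)" by simp
  \<comment> \<open>A continuous nonnegative function with integral 0 vanishes on the box;
    \<open>polys_vanish\<close> then extends this to the whole space.\<close>
  then have "q x * q x = 0" if "x \<in> cbox l u" for x
    using that ne cont by (intro has_integral_0_cbox_imp_0[of l u "\<lambda>x. q x * q x"]) auto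
  then have "q x = 0" if "x \<in> box l u" for x using that box_subset_cbox by force
  moreover obtain x where "x \<in> box l u" using ne by blast
  ultimately show ?thesis using polys_vanish[OF q open_box] by blast
qed

lemma polys_mult_integrable:
  assumes "Q \<in> rectangles" "p \<in> polys a" "q \<in> polys b"
  shows "set_integrable lebesgue Q (\<lambda>x. p x * q x)"
  using assms polys_continuous by (intro set_integrable_continuous_rectangle continuous_intros) auto

lemma avg_sum_mult:
  assumes Q: "Q \<in> rectangles" and B: "B \<subseteq> polys m" and p: "p \<in> polys m"
  shows "avg Q (\<lambda>x. (\<Sum>\<phi>\<in>B. c \<phi> * \<phi> x) * p x) = (\<Sum>\<phi>\<in>B. c \<phi> * avg Q (\<lambda>x. \<phi> x * p x))"
proof -
  have "avg Q (\<lambda>x. \<Sum>\<phi>\<in>B. c \<phi> * (\<phi> x * p x)) = (\<Sum>\<phi>\<in>B. avg Q (\<lambda>x. c \<phi> * (\<phi> x * p x)))"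
    using polys_mult_integrable[OF Q _ p] B by (intro avg_sum set_integrable_mult_right) auto
  then show ?thesis by (simp add: sum_distrib_right mult.assoc avg_cmult)
qed

lemma orthonormal_coeff:
  assumes Q: "Q \<in> rectangles" and B: "finite B" "B \<subseteq> polys m"
    "\<forall>\<phi>\<in>B. \<forall>\<psi>\<in>B. avg Q (\<lambda>x. \<phi> x * \<psi> x) = (if \<phi> = \<psi> then 1 else 0)" and "\<psi> \<in> B"
  shows "avg Q (\<lambda>x. (\<Sum>\<phi>\<in>B. c \<phi> * \<phi> x) * \<psi> x) = c \<psi>"
proof -
  have "avg Q (\<lambda>x. (\<Sum>\<phi>\<in>B. c \<phi> * \<phi> x) * \<psi> x) = (\<Sum>\<phi>\<in>B. c \<phi> * avg Q (\<lambda>x. \<phi> x * \<psi> x))"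
    using B \<open>\<psi> \<in> B\<close> by (intro avg_sum_mult[OF Q]) auto
  also have "\<dots> = (\<Sum>\<phi>\<in>B. if \<phi> = \<psi> then c \<phi> else 0)"
    using B(3) \<open>\<psi> \<in> B\<close> by (intro sum.cong) auto
  also have "\<dots> = c \<psi>" using B(1) \<open>\<psi> \<in> B\<close> by simp
  finally show ?thesis .
qed

text \<open>Induction over the spanning set. A new \<open>p\<close> either lies in the span already,
  namely if its component \<open>v\<close> orthogonal to \<open>B\<close> has norm 0, or contributes
  the normalized \<open>v\<close>.\<close>

lemma gram_schmidt:
  fixes Q :: "(real ^ 'n) set"
  assumes Q: "Q \<in> rectangles" and "finite J" "J \<subseteq> polys m"
  shows "\<exists>B. finite B \<and> B \<subseteq> polys m \<and>
     (\<forall>\<phi>\<in>B. \<forall>\<psi>\<in>B. avg Q (\<lambda>x. \<phi> x * \<psi> x) = (if \<phi> = \<psi> then 1 else 0)) \<and>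
     (\<forall>q\<in>J. \<exists>c. q = (\<lambda>x. \<Sum>\<phi>\<in>B. c \<phi> * \<phi> x))"
  using assms(2,3)
proof (induction J)
  case empty
  show ?case by (rule exI[of _ "{}"]) auto
next
  case (insert p J)
  then obtain B where B: "finite B" "B \<subseteq> polys m"
    "\<forall>\<phi>\<in>B. \<forall>\<psi>\<in>B. avg Q (\<lambda>x. \<phi> x * \<psi> x) = (if \<phi> = \<psi> then 1 else 0)"
    and span: "\<forall>q\<in>J. \<exists>c. q = (\<lambda>x. \<Sum>\<phi>\<in>B. c \<phi> * \<phi> x)" by auto
  have p: "p \<in> polys m" using insert by blast
  define c where "c \<phi> = avg Q (\<lambda>x. p x * \<phi> x)" for \<phi>
  define S where "S x = (\<Sum>\<phi>\<in>B. c \<phi> * \<phi> x)" for x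
  define v where "v x = p x - S x" for x
  have S: "S \<in> polys m" unfolding S_def using B(2) by (intro polys_sum polys_cmult) auto
  have v: "v \<in> polys m" unfolding v_def by (intro polys_diff p S)
  have orth: "avg Q (\<lambda>x. v x * \<psi> x) = 0" if "\<psi> \<in> B" for \<psi>
  proof -
    have \<psi>: "\<psi> \<in> polys m" using that B by blast
    have "avg Q (\<lambda>x. v x * \<psi> x) = avg Q (\<lambda>x. p x * \<psi> x - S x * \<psi> x)"
      by (simp add: v_def left_diff_distrib)
    also have "\<dots> = avg Q (\<lambda>x. p x * \<psi> x) - avg Q (\<lambda>x. S x * \<psi> x)"
      by (intro avg_diff polys_mult_integrable[OF Q p \<psi>] polys_mult_integrable[OF Q S \<psi>])
    also have "\<dots> = 0" unfolding S_def orthonormal_coeff[OF Q B that] c_def by simp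
    finally show ?thesis .
  qed
  define s where "s = avg Q (\<lambda>x. v x * v x)"
  show ?case
  proof (cases "s = 0")
    case True
    then have "v = (\<lambda>x. 0)" using avg_square_zero[OF Q v] s_def by simp
    then have "p = (\<lambda>x. \<Sum>\<phi>\<in>B. c \<phi> * \<phi> x)" by (auto simp: v_def S_def fun_eq_iff)
    then show ?thesis using B span by (intro exI[of _ B]) auto
  next
    case False
    then have s: "0 < s" using avg_nonneg[of Q "\<lambda>x. v x * v x"] by (simp add: s_def)
    define e where "e x = (1 / sqrt s) * v x" for x
    have e: "e \<in> polys m" unfolding e_def by (intro polys_cmult v)
    have oe: "avg Q (\<lambda>x. e x * \<psi> x) = 0" "avg Q (\<lambda>x. \<psi> x * e x) = 0" if "\<psi> \<in> B" for \<psi>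
    proof -
      have "avg Q (\<lambda>x. e x * \<psi> x) = (1 / sqrt s) * avg Q (\<lambda>x. v x * \<psi> x)"
        unfolding avg_cmult[symmetric] by (simp add: e_def)
      then show "avg Q (\<lambda>x. e x * \<psi> x) = 0" using orth[OF that] by simp
      then show "avg Q (\<lambda>x. \<psi> x * e x) = 0" by (simp add: mult.commute)
    qed
    have "avg Q (\<lambda>x. e x * e x) = (1 / s) * avg Q (\<lambda>x. v x * v x)"
      unfolding avg_cmult[symmetric] using s by (simp add: e_def)
    then have ee: "avg Q (\<lambda>x. e x * e x) = 1" using s by (simp add: s_def)
    \<comment> \<open>A unit vector orthogonal to \<open>B\<close> cannot belong to
      \<open>B\<close>; hence changing a coefficient at \<open>e\<close> leaves those on
      \<open>B\<close> alone.\<close>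
    have eB: "e \<notin> B" using oe(1)[of e] ee by auto
    have "\<exists>d. q = (\<lambda>x. \<Sum>\<phi>\<in>insert e B. d \<phi> * \<phi> x)" if "q \<in> insert p J" for q
    proof (cases "q = p")
      case True
      have px: "p x = (\<Sum>\<phi>\<in>insert e B. (c(e := sqrt s)) \<phi> * \<phi> x)" for x
      proof -
        have "(\<Sum>\<phi>\<in>B. (c(e := sqrt s)) \<phi> * \<phi> x) = S x"
          unfolding S_def using eB by (intro sum.cong) auto
        then show ?thesis using eB B(1) s by (simp add: e_def v_def)
      qed
      show ?thesis unfolding True by (intro exI[of _ "c(e := sqrt s)"] ext) (rule px)
    next
      case False
      then have "q \<in> J" using that by simp
      then obtain d where d: "q = (\<lambda>x. \<Sum>\<phi>\<in>B. d \<phi> * \<phi> x)"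
        using bspec[OF span] by (elim exE[rotated]) simp
      have dx: "(\<Sum>\<phi>\<in>insert e B. (d(e := 0)) \<phi> * \<phi> x) = (\<Sum>\<phi>\<in>B. d \<phi> * \<phi> x)" for x
      proof -
        have "(\<Sum>\<phi>\<in>B. (d(e := 0)) \<phi> * \<phi> x) = (\<Sum>\<phi>\<in>B. d \<phi> * \<phi> x)"
          using eB by (intro sum.cong) auto
        then show ?thesis using eB B(1) by simp
      qed
      show ?thesis unfolding d by (intro exI[of _ "d(e := 0)"] ext) (rule dx[symmetric])
    qed
    then show ?thesis using B e oe ee eB by (intro exI[of _ "insert e B"]) auto
  qed
qed

lemma orthonormal_basis_exists:
  assumes "Q \<in> rectangles" shows "\<exists>B. orthonormal_basis m Q B"
proof -
  have fin: "finite (monomial ` {k :: 'a \<Rightarrow> nat. sum k UNIV \<le> m})" by (intro finite_imageI finite_multi_indices)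
  have sub: "monomial ` {k :: 'a \<Rightarrow> nat. sum k UNIV \<le> m} \<subseteq> polys m" using monomial_in_polys by blast
  obtain B where B: "finite B" "B \<subseteq> polys m"
    "\<forall>\<phi>\<in>B. \<forall>\<psi>\<in>B. avg Q (\<lambda>x. \<phi> x * \<psi> x) = (if \<phi> = \<psi> then 1 else 0)"
    "\<forall>q\<in>monomial ` {k. sum k UNIV \<le> m}. \<exists>c. q = (\<lambda>x. \<Sum>\<phi>\<in>B. c \<phi> * \<phi> x)"
    using gram_schmidt[OF assms fin sub] by (elim exE conjE) (rule that)
  \<comment> \<open>Fixes the coefficients of all monomials at once, so that those of a polynomial
    arise by interchanging two sums.\<close>
  define d where "d k = (SOME c. monomial k = (\<lambda>x. \<Sum>\<phi>\<in>B. c \<phi> * \<phi> x))" for k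
  have d: "monomial k = (\<lambda>x. \<Sum>\<phi>\<in>B. d k \<phi> * \<phi> x)" if "sum k UNIV \<le> m" for k
  proof -
    have ex: "\<exists>c. monomial k = (\<lambda>x. \<Sum>\<phi>\<in>B. c \<phi> * \<phi> x)"
      by (rule bspec[OF B(4)], rule imageI) (simp add: that)
    show ?thesis unfolding d_def by (rule someI_ex[OF ex])
  qed
  have "\<exists>c. q = (\<lambda>x. \<Sum>\<phi>\<in>B. c \<phi> * \<phi> x)" if q: "q \<in> polys m" for q
  proof -
    obtain c where c: "q = (\<lambda>x. \<Sum>k | sum k UNIV \<le> m. c k * monomial k x)" using q polysE by blast
    have qx: "q x = (\<Sum>\<phi>\<in>B. (\<Sum>k | sum k UNIV \<le> m. c k * d k \<phi>) * \<phi> x)" for x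
    proof -
      have "q x = (\<Sum>k | sum k UNIV \<le> m. c k * (\<Sum>\<phi>\<in>B. d k \<phi> * \<phi> x))"
        unfolding c using d by (intro sum.cong) (auto simp: fun_eq_iff)
      also have "\<dots> = (\<Sum>\<phi>\<in>B. \<Sum>k | sum k UNIV \<le> m. c k * (d k \<phi> * \<phi> x))"
        unfolding sum_distrib_left by (rule sum.swap)
      finally show ?thesis by (simp add: sum_distrib_right mult.assoc)
    qed
    show ?thesis
      by (intro exI[of _ "\<lambda>\<phi>. \<Sum>k | sum k UNIV \<le> m. c k * d k \<phi>"] ext) (rule qx)
  qed
  then have "orthonormal_basis m Q B" unfolding orthonormal_basis_def using B by blast
  then show ?thesis by blast
qed

text \<open>Orthonormality forces the coefficients of any expansion to be inner products; the second
  part is Parseval's identity.\<close>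

lemma orthonormal_expand:
  assumes Q: "Q \<in> rectangles" and B: "orthonormal_basis m Q B" and q: "q \<in> polys m"
  shows "q = (\<lambda>x. \<Sum>\<phi>\<in>B. avg Q (\<lambda>y. q y * \<phi> y) * \<phi> x)"
    "avg Q (\<lambda>x. q x * q x) = (\<Sum>\<phi>\<in>B. (avg Q (\<lambda>y. q y * \<phi> y))\<^sup>2)"
proof -
  have B': "finite B" "B \<subseteq> polys m"
    "\<forall>\<phi>\<in>B. \<forall>\<psi>\<in>B. avg Q (\<lambda>x. \<phi> x * \<psi> x) = (if \<phi> = \<psi> then 1 else 0)"
    "\<forall>q\<in>polys m. \<exists>c. q = (\<lambda>x. \<Sum>\<phi>\<in>B. c \<phi> * \<phi> x)"
    using B unfolding orthonormal_basis_def by blast+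
  obtain c where c: "q = (\<lambda>x. \<Sum>\<phi>\<in>B. c \<phi> * \<phi> x)" using B'(4) q by blast
  have cc: "avg Q (\<lambda>y. q y * \<phi> y) = c \<phi>" if "\<phi> \<in> B" for \<phi>
    unfolding c using orthonormal_coeff[OF Q B'(1-3) that] by simp
  then show e: "q = (\<lambda>x. \<Sum>\<phi>\<in>B. avg Q (\<lambda>y. q y * \<phi> y) * \<phi> x)"
    using c by (auto simp: fun_eq_iff intro!: sum.cong)
  have "avg Q (\<lambda>x. q x * q x) = avg Q (\<lambda>x. (\<Sum>\<phi>\<in>B. c \<phi> * \<phi> x) * q x)" using c by metis
  also have "\<dots> = (\<Sum>\<phi>\<in>B. c \<phi> * avg Q (\<lambda>x. \<phi> x * q x))" by (rule avg_sum_mult[OF Q B'(2) q])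
  also have "\<dots> = (\<Sum>\<phi>\<in>B. (avg Q (\<lambda>y. q y * \<phi> y))\<^sup>2)"
    using cc by (intro sum.cong) (auto simp: power2_eq_square mult.commute)
  finally show "avg Q (\<lambda>x. q x * q x) = (\<Sum>\<phi>\<in>B. (avg Q (\<lambda>y. q y * \<phi> y))\<^sup>2)" .
qed

section \<open>Suprema of polynomials against averages\<close>

lemma polys_sup_le_L2_unit_cube:
  "\<exists>K>0. \<forall>q\<in>polys m. \<forall>x\<in>cbox 0 1 :: (real ^ 'n) set. \<bar>q x\<bar> \<le> K * sqrt (avg (cbox 0 1) (\<lambda>x. q x * q x))"
proof -
  define U where "U = (cbox 0 1 :: (real ^ 'n) set)"
  have U: "U \<in> rectangles" using unit_cube_corners by (auto simp: has_corners_def U_def)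
  obtain B where B: "orthonormal_basis m U B" using orthonormal_basis_exists[OF U] by blast
  have fB: "finite B" "B \<subseteq> polys m" using B by (auto simp: orthonormal_basis_def)
  have "\<exists>b. \<forall>x\<in>U. \<bar>\<phi> x\<bar> \<le> b" if "\<phi> \<in> B" for \<phi>
  proof -
    have "compact (\<phi> ` U)" unfolding U_def
      using polys_continuous fB that by (intro compact_continuous_image) auto
    then show ?thesis using compact_imp_bounded bounded_iff by (metis image_eqI real_norm_def)
  qed
  then obtain b where b: "\<And>\<phi> x. \<phi> \<in> B \<Longrightarrow> x \<in> U \<Longrightarrow> \<bar>\<phi> x\<bar> \<le> b \<phi>" by metis
  \<comment> \<open>The summand 1 keeps \<open>K\<close> positive whatever the bounds
    \<open>b\<close> are.\<close>
  define K where "K = (\<Sum>\<phi>\<in>B. \<bar>b \<phi>\<bar>) + 1"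
  have K: "K > 0" unfolding K_def by (intro add_nonneg_pos sum_nonneg) auto
  have "\<bar>q x\<bar> \<le> K * sqrt (avg U (\<lambda>x. q x * q x))" if q: "q \<in> polys m" and x: "x \<in> U" for q x
  proof -
    define c where "c \<phi> = avg U (\<lambda>y. q y * \<phi> y)" for \<phi>
    define N where "N = sqrt (avg U (\<lambda>x. q x * q x))"
    have N: "N = sqrt (\<Sum>\<phi>\<in>B. (c \<phi>)\<^sup>2)" unfolding N_def c_def orthonormal_expand(2)[OF U B q] ..
    have N0: "0 \<le> N" unfolding N by (simp add: sum_nonneg)
    \<comment> \<open>By Parseval each single coefficient is at most the L2 norm.\<close>
    have cN: "\<bar>c \<phi>\<bar> \<le> N" if "\<phi> \<in> B" for \<phi>
    proof -
      have "(c \<phi>)\<^sup>2 \<le> (\<Sum>\<phi>\<in>B. (c \<phi>)\<^sup>2)" by (rule member_le_sum[OF that]) (auto simp: fB)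
      then show ?thesis unfolding N by (simp add: real_le_rsqrt)
    qed
    have "\<bar>q x\<bar> = \<bar>\<Sum>\<phi>\<in>B. c \<phi> * \<phi> x\<bar>"
      using orthonormal_expand(1)[OF U B q] unfolding c_def by metis
    also have "\<dots> \<le> (\<Sum>\<phi>\<in>B. \<bar>c \<phi> * \<phi> x\<bar>)" by (rule sum_abs)
    also have "\<dots> \<le> (\<Sum>\<phi>\<in>B. N * \<bar>b \<phi>\<bar>)"
    proof (rule sum_mono)
      fix \<phi> assume "\<phi> \<in> B"
      then show "\<bar>c \<phi> * \<phi> x\<bar> \<le> N * \<bar>b \<phi>\<bar>"
        unfolding abs_mult using cN b[OF _ x] N0 by (intro mult_mono) (auto intro: order_trans[OF _ abs_ge_self])
    qed
    also have "\<dots> \<le> K * N" unfolding K_def using N0 by (simp add: sum_distrib_left[symmetric] algebra_simps)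
    finally show ?thesis unfolding N_def .
  qed
  then show ?thesis using K unfolding U_def by blast
qed

text \<open>Pulling back to the unit cube preserves \<open>polys m\<close> and the average of the
  square, so the constant of the cube, which comes from finite dimension, is valid for every
  rectangle.\<close>

lemma polys_sup_le_L2:
  "\<exists>K>0. \<forall>Q\<in>rectangles :: (real ^ 'n) set set. \<forall>q\<in>polys m. \<forall>x\<in>Q.
    \<bar>q x\<bar> \<le> K * sqrt (avg Q (\<lambda>x. q x * q x))"
proof -
  obtain K where K: "0 < K" "\<And>q x. q \<in> polys m \<Longrightarrow> x \<in> (cbox 0 1 :: (real ^ 'n) set) \<Longrightarrow>
    \<bar>q x\<bar> \<le> K * sqrt (avg (cbox 0 1) (\<lambda>x. q x * q x))"
    using polys_sup_le_L2_unit_cube by blast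
  have "\<bar>q x\<bar> \<le> K * sqrt (avg Q (\<lambda>x. q x * q x))"
    if Q: "Q \<in> rectangles" and q: "q \<in> polys m" and x: "x \<in> Q" for Q :: "(real ^ 'n) set" and q x
  proof -
    obtain l u where lu: "has_corners Q l u" using rectangles_corners Q by blast
    have l: "l $ i < u $ i" "l $ i \<le> x $ i" "x $ i \<le> u $ i" for i
      using lu x by (auto simp: has_corners_def mem_box_cart subset_eq)
    define T where "T y = (\<chi> i. l $ i + (u $ i - l $ i) * y $ i)" for y :: "real ^ 'n"
    define r where "r y = q (T y)" for y
    have r: "r \<in> polys m" unfolding r_def T_def by (rule polys_affine[OF q])
    define y where "y = (\<chi> i. (x $ i - l $ i) / (u $ i - l $ i))"
    have y: "y \<in> cbox 0 1" using l by (auto simp: y_def mem_box_cart less_imp_le)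
    have Ty: "T y = x" using l(1) by (simp add: T_def y_def vec_eq_iff less_imp_neq[symmetric])
    have cq: "continuous_on UNIV (\<lambda>x. q x * q x)" using polys_continuous[OF q] by (intro continuous_intros)
    have cr: "continuous_on UNIV (\<lambda>x. r x * r x)" using polys_continuous[OF r] by (intro continuous_intros)
    have "avg (cbox 0 1) (\<lambda>x. r x * r x) = integral (cbox 0 1) (\<lambda>x. r x * r x)"
      using avg_eq_integral[OF unit_cube_corners cr] by simp
    also have "\<dots> = avg Q (\<lambda>x. q x * q x)"
      unfolding avg_scale[OF lu cq] by (simp add: r_def T_def)
    finally show ?thesis using K(2)[OF r y] Ty by (simp add: r_def)
  qed
  then show ?thesis using K(1) by blast
qed

text \<open>One basis for all functions, which makes \<open>proj m Q\<close> visibly linear. An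
  equation for each \<open>f\<close> separately would allow the basis to vary with
  \<open>f\<close>.\<close>

lemma proj_basis:
  assumes "Q \<in> rectangles"
  shows "\<exists>B. orthonormal_basis m Q B \<and>
    proj m Q = (\<lambda>f x. \<Sum>\<phi>\<in>B. avg Q (\<lambda>y. f y * \<phi> y) * \<phi> x)"
proof (intro exI conjI)
  show "orthonormal_basis m Q (SOME B. orthonormal_basis m Q B)"
    by (rule someI_ex) (rule orthonormal_basis_exists[OF assms])
qed (simp add: fun_eq_iff proj_def Let_def)

lemma proj_in_polys: "Q \<in> rectangles \<Longrightarrow> proj m Q f \<in> polys m"
  using proj_basis[of Q m] by (auto simp: orthonormal_basis_def intro!: polys_sum polys_cmult)

text \<open>Lets a difference of two projections be written as a single projection in
  \<open>stopping_children\<close>.\<close>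

lemma proj_poly:
  assumes Q: "Q \<in> rectangles" and q: "q \<in> polys m" shows "proj m Q q = q"
proof -
  obtain B where B: "orthonormal_basis m Q B"
    "proj m Q = (\<lambda>f x. \<Sum>\<phi>\<in>B. avg Q (\<lambda>y. f y * \<phi> y) * \<phi> x)"
    using proj_basis[OF Q, of m] by (elim exE conjE) (rule that)
  show ?thesis unfolding B(2) by (rule orthonormal_expand(1)[OF Q B(1) q, symmetric])
qed

lemma proj_diff:
  assumes Q: "Q \<in> rectangles" and f: "set_integrable lebesgue Q f" and g: "set_integrable lebesgue Q g"
  shows "proj m Q (\<lambda>x. f x - g x) = (\<lambda>x. proj m Q f x - proj m Q g x)"
proof -
  obtain B where B: "orthonormal_basis m Q B"
    "proj m Q = (\<lambda>f x. \<Sum>\<phi>\<in>B. avg Q (\<lambda>y. f y * \<phi> y) * \<phi> x)"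
    using proj_basis[OF Q, of m] by (elim exE conjE) (rule that)
  have "avg Q (\<lambda>y. (f y - g y) * \<phi> y) = avg Q (\<lambda>y. f y * \<phi> y) - avg Q (\<lambda>y. g y * \<phi> y)" if "\<phi> \<in> B" for \<phi>
  proof -
    have "\<phi> \<in> polys m" using B(1) that by (auto simp: orthonormal_basis_def)
    then have "continuous_on UNIV \<phi>" by (rule polys_continuous)
    then show ?thesis unfolding left_diff_distrib
      using f g by (intro avg_diff set_integrable_mult_continuous[OF Q])
  qed
  then show ?thesis unfolding B(2) by (simp add: left_diff_distrib sum_subtractf)
qed

text \<open>Projecting is integration against a kernel, so a uniform bound for the kernel gives a
  bound from L1 to sup. The estimate for polynomials is applied to the kernel twice: at
  \<open>x\<close> it bounds \<open>k x\<close> by K^2, and with this it bounds \<open>k\<close> at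
  every \<open>y\<close>.\<close>

lemma proj_sup_le_avg:
  "\<exists>C>0. \<forall>Q\<in>rectangles :: (real ^ 'n) set set. \<forall>g. set_integrable lebesgue Q g \<longrightarrow>
    (\<forall>x\<in>Q. \<bar>proj m Q g x\<bar> \<le> C * avg Q (\<lambda>y. \<bar>g y\<bar>))"
proof -
  obtain K where K: "0 < K" "\<And>Q q x. Q \<in> rectangles \<Longrightarrow> q \<in> polys m \<Longrightarrow> x \<in> (Q :: (real ^ 'n) set) \<Longrightarrow>
    \<bar>q x\<bar> \<le> K * sqrt (avg Q (\<lambda>x. q x * q x))"
    using polys_sup_le_L2 by metis
  have "\<bar>proj m Q g x\<bar> \<le> K\<^sup>2 * avg Q (\<lambda>y. \<bar>g y\<bar>)"
    if Q: "Q \<in> rectangles" and g: "set_integrable lebesgue Q g" and x: "x \<in> Q"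
    for Q :: "(real ^ 'n) set" and g x
  proof -
    obtain B where B: "orthonormal_basis m Q B"
      "proj m Q = (\<lambda>f x. \<Sum>\<phi>\<in>B. avg Q (\<lambda>y. f y * \<phi> y) * \<phi> x)"
      using proj_basis[OF Q, of m] by (elim exE conjE) (rule that)
    have fB: "finite B" "B \<subseteq> polys m"
      "\<forall>\<phi>\<in>B. \<forall>\<psi>\<in>B. avg Q (\<lambda>x. \<phi> x * \<psi> x) = (if \<phi> = \<psi> then 1 else 0)"
      using B(1) by (auto simp: orthonormal_basis_def)
    (* the reproducing kernel at x: it does not depend on the basis, and k x = avg Q (k^2) *)
    define k where "k y = (\<Sum>\<phi>\<in>B. \<phi> x * \<phi> y)" for y
    have k: "k \<in> polys m" unfolding k_def using fB by (intro polys_sum polys_cmult) auto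
    have kx: "avg Q (\<lambda>y. k y * k y) = k x"
    proof -
      have "avg Q (\<lambda>y. k y * \<phi> y) = \<phi> x" if "\<phi> \<in> B" for \<phi>
        unfolding k_def by (rule orthonormal_coeff[OF Q fB that])
      then show ?thesis unfolding orthonormal_expand(2)[OF Q B(1) k] by (simp add: k_def power2_eq_square)
    qed
    have kx0: "0 \<le> k x" unfolding kx[symmetric] by (rule avg_nonneg) simp
    have "k x \<le> K * sqrt (k x)" using K(2)[OF Q k x] kx by simp
    then have "sqrt (k x) * sqrt (k x) \<le> K * sqrt (k x)" using kx0 by simp
    \<comment> \<open>\<open>sqrt (k x)\<close> can be cancelled when it is nonzero; when it is 0
      the claim is \<open>0 \<le> K\<close>.\<close>
    then have sK: "sqrt (k x) \<le> K"
      using K(1) kx0 mult_le_cancel_right[of "sqrt (k x)" "sqrt (k x)" K]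
      by (cases "k x = 0") (simp_all del: real_sqrt_mult_self)
    have kb: "\<bar>k y\<bar> \<le> K\<^sup>2" if "y \<in> Q" for y
    proof -
      have "\<bar>k y\<bar> \<le> K * sqrt (k x)" using K(2)[OF Q k that] kx by simp
      also have "\<dots> \<le> K * K" using sK K(1) by simp
      finally show ?thesis by (simp add: power2_eq_square)
    qed
    have gk: "set_integrable lebesgue Q (\<lambda>y. g y * k y)"
      by (rule set_integrable_mult_continuous[OF Q polys_continuous[OF k] g])
    have "proj m Q g x = avg Q (\<lambda>y. g y * k y)"
    proof -
      have "avg Q (\<lambda>y. \<Sum>\<phi>\<in>B. \<phi> x * (g y * \<phi> y)) = (\<Sum>\<phi>\<in>B. avg Q (\<lambda>y. \<phi> x * (g y * \<phi> y)))"
        using fB(2) polys_continuous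
        by (intro avg_sum set_integrable_mult_right set_integrable_mult_continuous[OF Q _ g]) auto
      then have "avg Q (\<lambda>y. \<Sum>\<phi>\<in>B. \<phi> x * (g y * \<phi> y)) = (\<Sum>\<phi>\<in>B. avg Q (\<lambda>y. g y * \<phi> y) * \<phi> x)"
        by (simp only: avg_cmult mult.commute)
      moreover have "(\<Sum>\<phi>\<in>B. \<phi> x * (g y * \<phi> y)) = g y * k y" for y
        by (simp add: k_def sum_distrib_left mult.left_commute)
      ultimately show ?thesis unfolding B(2) by simp
    qed
    also have "\<bar>\<dots>\<bar> \<le> avg Q (\<lambda>y. \<bar>g y * k y\<bar>)" by (rule abs_avg_le[OF gk])
    also have "\<dots> \<le> avg Q (\<lambda>y. K\<^sup>2 * \<bar>g y\<bar>)"
    proof (rule avg_mono)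
      show "set_integrable lebesgue Q (\<lambda>y. \<bar>g y * k y\<bar>)" by (rule set_integrable_abs[OF gk])
      show "set_integrable lebesgue Q (\<lambda>y. K\<^sup>2 * \<bar>g y\<bar>)"
        by (intro set_integrable_mult_right set_integrable_abs[OF g])
      fix y assume "y \<in> Q"
      then show "\<bar>g y * k y\<bar> \<le> K\<^sup>2 * \<bar>g y\<bar>"
        using mult_right_mono[OF kb, of y "\<bar>g y\<bar>"] by (simp add: abs_mult mult.commute)
    qed
    also have "\<dots> = K\<^sup>2 * avg Q (\<lambda>y. \<bar>g y\<bar>)" by (rule avg_cmult)
    finally show ?thesis .
  qed
  then show ?thesis using K(1) by (intro exI[of _ "K\<^sup>2"]) auto
qed

section \<open>Sparse trees and the maximal function\<close>

lemma locally_integrable_rectangle: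
  assumes "locally_integrable f" "Q \<in> rectangles" shows "set_integrable lebesgue Q f"
proof -
  obtain l u where "has_corners Q l u" using rectangles_corners assms(2) by blast
  then have "Q \<subseteq> cbox l u" by (simp add: has_corners_def)
  moreover have "set_integrable lebesgue (cbox l u) f"
    using assms(1) unfolding locally_integrable_def by (simp add: compact_cbox)
  ultimately show ?thesis using rectangles_sets[OF assms(2)] by (auto intro: set_integrable_subset)
qed

text \<open>Sparsity is a statement on Lebesgue measure alone. What it implies for the weight is
  derived below through the maximal function.\<close>

locale sparse_tree = set_tree D ch for D :: "(real ^ 'n) set set" and ch +
  fixes R :: "(real ^ 'n) set" and w :: "real ^ 'n \<Rightarrow> real"
  assumes root: "R \<in> D" and rect: "D \<subseteq> rectangles" and sub: "Q \<in> D \<Longrightarrow> Q \<subseteq> R"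
    and sparse: "Q \<in> D \<Longrightarrow> emeasure lebesgue (\<Union>(ch Q)) \<le> ennreal (1/2) * emeasure lebesgue Q"
    and w_int: "set_integrable lebesgue R w" and w_nonneg: "0 \<le> w x"
begin

text \<open>Cutting off at \<open>R\<close> makes the weighted measure finite, as
  \<open>weighted_tree\<close> requires, without changing it on subsets of \<open>R\<close>.\<close>

definition wM :: "(real ^ 'n) measure" where
  "wM = density lebesgue (\<lambda>x. ennreal (indicator R x *\<^sub>R w x))"

lemma sets_wM: "sets wM = sets lebesgue"
  by (simp add: wM_def)

lemma node_sets: "Q \<in> D \<Longrightarrow> Q \<in> sets lebesgue"
  using rect rectangles_sets by blast

lemma emeasure_wM: "X \<in> sets lebesgue \<Longrightarrow> X \<subseteq> R \<Longrightarrow> emeasure wM X = wmeas w X"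
  unfolding wM_def wmeas_def using w_int
  by (intro emeasure_density_indicator) (auto simp: set_integrable_def)

lemma finite_wM: "finite_measure wM"
proof
  have "emeasure wM (space wM) = (\<integral>\<^sup>+x. ennreal (indicator R x *\<^sub>R w x) \<partial>lebesgue)"
    unfolding wM_def using w_int by (subst emeasure_density) (auto simp: set_integrable_def)
  also have "\<dots> = ennreal (LINT x:R|lebesgue. w x)" unfolding set_lebesgue_integral_def
    by (rule nn_integral_eq_integral)
       (use w_int w_nonneg in \<open>auto simp: set_integrable_def split: split_indicator\<close>)
  finally show "emeasure wM (space wM) \<noteq> \<infinity>" by simp
qed

lemma layer_sets: "Q \<in> D \<Longrightarrow> layer k Q \<in> sets lebesgue"
  using node_sets by (intro sets_layer) auto

lemma emeasure_difference_ge: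
  assumes "Q \<in> D"
  shows "emeasure lebesgue Q \<le> ennreal 2 * emeasure lebesgue (Q - \<Union>(ch Q))"
proof -
  have Qr: "Q \<in> rectangles" using assms rect by blast
  have U: "\<Union>(ch Q) \<in> sets lebesgue" using layer_sets[OF assms, of 1] by (simp add: layer_def)
  have UQ: "\<Union>(ch Q) \<subseteq> Q" using children_subset assms by blast
  have Ul: "\<Union>(ch Q) \<in> lmeasurable" by (rule fmeasurableI2[OF rectangles_lmeasurable[OF Qr] UQ U])
  have El: "Q - \<Union>(ch Q) \<in> lmeasurable" using Ul rectangles_lmeasurable[OF Qr] by (rule fmeasurable.Diff[rotated])
  have "ennreal (measure lebesgue (\<Union>(ch Q))) \<le> ennreal (1/2 * measure lebesgue Q)"
    using sparse[OF assms]
    unfolding emeasure_eq_measure2[OF Ul] rectangles_emeasure[OF Qr]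
    by (simp only: ennreal_mult'' measure_nonneg)
  then have "measure lebesgue (\<Union>(ch Q)) \<le> 1/2 * measure lebesgue Q"
    by (subst (asm) ennreal_le_iff) auto
  moreover have "measure lebesgue (Q - \<Union>(ch Q)) = measure lebesgue Q - measure lebesgue (\<Union>(ch Q))"
    using measurable_measure_Diff[OF rectangles_lmeasurable[OF Qr] U UQ] .
  ultimately have "ennreal (measure lebesgue Q) \<le> ennreal (2 * measure lebesgue (Q - \<Union>(ch Q)))"
    by (intro ennreal_leI) simp
  then show ?thesis
    unfolding emeasure_eq_measure2[OF El] rectangles_emeasure[OF Qr] by (simp add: ennreal_mult'')
qed

text \<open>The sets \<open>Q' - \<Union>(ch Q')\<close> are disjoint and occupy half of each \<open>Q'\<close>, and there the
  maximal function is at least the average of \<open>w\<close> over \<open>Q'\<close>.\<close>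

lemma carleson:
  assumes Q: "Q \<in> D"
  shows "(\<Sum>k<n. emeasure wM (layer k Q))
    \<le> ennreal 2 * (\<integral>\<^sup>+x\<in>Q. strong_maximal (\<lambda>y. w y * indicator Q y) x \<partial>lebesgue)"
proof -
  define r where "r P = wmeas w P / emeasure lebesgue P" for P
  define I where "I = {P \<in> D. P \<subseteq> Q}"
  \<comment> \<open>A countable supremum, hence measurable, below the strong maximal function, which
    is a supremum over uncountably many rectangles. The sum over generations is formed with
    \<open>H\<close>, since adding integrals requires measurability.\<close>
  define H where "H x = (SUP P\<in>I. r P * indicator P x)" for x
  have cI: "countable I" using countable_nodes by (auto simp: I_def intro: countable_subset)
  have H [measurable]: "H \<in> borel_measurable lebesgue" unfolding H_def
    using cI node_sets by (intro borel_measurable_SUP) (auto simp: I_def)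
  have H_le: "H x \<le> strong_maximal (\<lambda>y. w y * indicator Q y) x" for x
    unfolding H_def
  proof (rule SUP_least)
    fix P assume "P \<in> I"
    then have P: "P \<in> rectangles" "P \<subseteq> Q" using rect by (auto simp: I_def)
    show "r P * indicator P x \<le> strong_maximal (\<lambda>y. w y * indicator Q y) x"
    proof (cases "x \<in> P")
      case True
      have "(\<integral>\<^sup>+y\<in>P. ennreal \<bar>w y * indicator Q y\<bar> \<partial>lebesgue) = wmeas w P"
        unfolding wmeas_def using P(2) w_nonneg
        by (intro nn_integral_cong) (auto split: split_indicator)
      then have "r P \<le> strong_maximal (\<lambda>y. w y * indicator Q y) x"
        unfolding r_def strong_maximal_def using P(1) True by (intro SUP_upper2[of P]) auto
      then show ?thesis using True by simp
    qed simp
  qed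
  \<comment> \<open>The part of generation \<open>k\<close> left uncovered by the next one. These
    parts are disjoint for different \<open>k\<close>, so summing over generations counts no point
    twice.\<close>
  define S where "S k = layer k Q - layer (Suc k) Q" for k
  have S [measurable]: "S k \<in> sets lebesgue" for k unfolding S_def using layer_sets[OF Q] by auto
  have SQ: "S k \<subseteq> Q" for k unfolding S_def using layer_subset[OF Q] by blast
  have "emeasure wM (layer k Q) \<le> ennreal 2 * (\<integral>\<^sup>+x. H x * indicator (S k) x \<partial>lebesgue)" for k
  proof -
    \<comment> \<open>Packaged as a measure, so that the bound on single nodes can be added up over
      a disjoint generation.\<close>
    define N where "N = density lebesgue (\<lambda>x. H x * indicator (S k) x)"
    have "emeasure wM (\<Union>P\<in>gen ch k Q. P) \<le> ennreal 2 * emeasure N (\<Union>(gen ch k Q))"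
    proof (rule emeasure_Union_le_family)
      show "countable (gen ch k Q)" "disjoint (gen ch k Q)" using countable_gen gen_disjoint Q by auto
      show "gen ch k Q \<subseteq> sets N" using gen_nodes[OF Q] node_sets by (auto simp: N_def)
      fix P assume P: "P \<in> gen ch k Q"
      then have PD: "P \<in> D" "P \<subseteq> Q" using gen_nodes[OF Q] gen_subset[OF Q] by blast+
      then have PI: "P \<in> I" by (simp add: I_def)
      have Ps: "P \<in> sets lebesgue" using node_sets PD by blast
      show "P \<in> sets wM" using Ps by (simp add: sets_wM)
      \<comment> \<open>No other node of generation \<open>k\<close> contains \<open>x\<close>, so a
        point missed by the children of \<open>P\<close> is missed by the whole next
        generation.\<close>
      have PE: "P - \<Union>(ch P) \<subseteq> P \<inter> S k"
      proof
        fix x assume x: "x \<in> P - \<Union>(ch P)"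
        have "x \<notin> layer (Suc k) Q"
        proof
          assume "x \<in> layer (Suc k) Q"
          then obtain P' X where P': "P' \<in> gen ch k Q" "X \<in> ch P'" "x \<in> X" by (auto simp: layer_def)
          then have "x \<in> P'" using children_subset gen_nodes[OF Q] by blast
          then have "P' = P" using gen_unique[OF Q P'(1) P] x by blast
          then show False using x P' by blast
        qed
        then show "x \<in> P \<inter> S k" using x P by (auto simp: S_def layer_def)
      qed
      have Es: "P - \<Union>(ch P) \<in> sets lebesgue"
        using layer_sets[OF PD(1), of 1] Ps by (auto simp: layer_def)
      have Pr: "P \<in> rectangles" using PD rect by blast
      have "emeasure wM P = wmeas w P" using emeasure_wM[OF Ps] sub PD by blast
      also have "\<dots> = r P * emeasure lebesgue P"
        unfolding r_def using rectangles_measure_pos[OF Pr] rectangles_emeasure[OF Pr]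
        by (simp add: ennreal_divide_times ennreal_divide_self)
      also have "\<dots> \<le> r P * (ennreal 2 * emeasure lebesgue (P - \<Union>(ch P)))"
        by (intro mult_left_mono emeasure_difference_ge[OF PD(1)]) simp
      also have "\<dots> = ennreal 2 * (r P * emeasure lebesgue (P - \<Union>(ch P)))"
        by (simp add: mult.left_commute)
      also have "r P * emeasure lebesgue (P - \<Union>(ch P)) = (\<integral>\<^sup>+x. r P * indicator (P - \<Union>(ch P)) x \<partial>lebesgue)"
        using Es by (simp add: nn_integral_cmult_indicator)
      also have "\<dots> \<le> (\<integral>\<^sup>+x. (H x * indicator (S k) x) * indicator P x \<partial>lebesgue)"
      proof (rule nn_integral_mono)
        fix x
        show "r P * indicator (P - \<Union>(ch P)) x \<le> (H x * indicator (S k) x) * indicator P x"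
        proof (cases "x \<in> P - \<Union>(ch P)")
          case True
          then have "r P * indicator P x \<le> H x" unfolding H_def by (intro SUP_upper PI)
          then show ?thesis using True PE by (auto split: split_indicator)
        qed simp
      qed
      also have "\<dots> = emeasure N P" unfolding N_def using Ps by (subst emeasure_density) auto
      finally show "emeasure wM P \<le> ennreal 2 * emeasure N P" by (simp add: mult_left_mono)
    qed auto
    also have "emeasure N (\<Union>(gen ch k Q)) \<le> emeasure N (space N)" by (rule emeasure_space)
    also have "\<dots> = (\<integral>\<^sup>+x. H x * indicator (S k) x \<partial>lebesgue)"
      unfolding N_def by (subst emeasure_density) auto
    finally show ?thesis by (simp add: layer_def mult_left_mono)
  qed
  then have "(\<Sum>k<n. emeasure wM (layer k Q))
      \<le> (\<Sum>k<n. ennreal 2 * (\<integral>\<^sup>+x. H x * indicator (S k) x \<partial>lebesgue))"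
    by (rule sum_mono)
  also have "\<dots> = ennreal 2 * (\<integral>\<^sup>+x. (\<Sum>k<n. H x * indicator (S k) x) \<partial>lebesgue)"
    by (subst nn_integral_sum) (auto simp: sum_distrib_left)
  also have "(\<integral>\<^sup>+x. (\<Sum>k<n. H x * indicator (S k) x) \<partial>lebesgue)
      \<le> (\<integral>\<^sup>+x\<in>Q. strong_maximal (\<lambda>y. w y * indicator Q y) x \<partial>lebesgue)"
  proof (rule nn_integral_mono)
    fix x
    have disj: "disjoint_family_on S {..<n}"
      unfolding disjoint_family_on_def
    proof (intro ballI impI)
      fix i j :: nat assume "i \<noteq> j"
      then have "layer j Q \<subseteq> layer (Suc i) Q \<or> layer i Q \<subseteq> layer (Suc j) Q"
        using layer_antimono[OF Q, of "Suc i" j] layer_antimono[OF Q, of "Suc j" i] by linarith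
      then show "S i \<inter> S j = {}" unfolding S_def by blast
    qed
    have "(\<Sum>k<n. H x * indicator (S k) x) = H x * (\<Sum>k<n. indicator (S k) x)"
      by (rule sum_distrib_left[symmetric])
    also have "(\<Sum>k<n. indicator (S k) x :: ennreal) = indicator (\<Union>k<n. S k) x"
      by (rule indicator_UN_disjoint[OF _ disj, symmetric]) simp
    also have "H x * \<dots> \<le> strong_maximal (\<lambda>y. w y * indicator Q y) x * indicator Q x"
      using H_le SQ by (intro mult_mono) (auto split: split_indicator)
    finally show "(\<Sum>k<n. H x * indicator (S k) x)
      \<le> strong_maximal (\<lambda>y. w y * indicator Q y) x * indicator Q x" .
  qed
  finally show ?thesis by (simp add: mult_left_mono)
qed

text \<open>The layers decrease, so \<open>K\<close> times the measure of layer \<open>K\<close> is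
  at most the sum over the earlier layers. By \<open>carleson\<close> and the definition of [w] this
  sum is at most 2 [w] w(Q), hence at most (K / 2) w(Q): the 4 in the choice of \<open>K\<close> is
  what yields 1/2.\<close>

lemma layer_half:
  assumes Q: "Q \<in> D" and fin: "A_infty_const w < top"
    and K: "4 * enn2real (A_infty_const w) \<le> real K" "0 < K"
  shows "emeasure wM (layer K Q) \<le> ennreal (1/2) * emeasure wM Q"
proof -
  interpret W: finite_measure wM by (rule finite_wM)
  have Qs: "Q \<in> sets lebesgue" "Q \<subseteq> R" using node_sets sub Q by auto
  have LQ: "emeasure wM (layer K Q) \<le> emeasure wM Q"
    using layer_subset[OF Q] Qs by (intro emeasure_mono) (auto simp: sets_wM)
  show ?thesis
  proof (cases "emeasure wM Q = 0")
    case True then show ?thesis using LQ by simp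
  next
    case False
    define A where "A = enn2real (A_infty_const w)"
    have A: "A_infty_const w = ennreal A" "0 \<le> A" using fin by (auto simp: A_def)
    define X where "X = (\<integral>\<^sup>+x\<in>Q. strong_maximal (\<lambda>y. w y * indicator Q y) x \<partial>lebesgue)"
    have wQ: "emeasure wM Q = wmeas w Q" by (rule emeasure_wM[OF Qs])
    have "X / wmeas w Q \<le> A_infty_const w" unfolding A_infty_const_def X_def
      using Q rect by (intro SUP_upper) auto
    then have "X / emeasure wM Q * emeasure wM Q \<le> ennreal A * emeasure wM Q"
      unfolding wQ A(1) by (rule mult_right_mono) simp
    then have X: "X \<le> ennreal A * emeasure wM Q"
      using False W.emeasure_finite[of Q] by (simp add: ennreal_divide_times ennreal_divide_self top.not_eq_extremum less_top[symmetric])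
    have "ennreal (real K) * emeasure wM (layer K Q) = (\<Sum>k<K. emeasure wM (layer K Q))"
      by (simp add: ennreal_of_nat_eq_real_of_nat)
    also have "\<dots> \<le> (\<Sum>k<K. emeasure wM (layer k Q))"
      using layer_sets[OF Q] layer_antimono[OF Q]
      by (intro sum_mono emeasure_mono) (auto simp: sets_wM)
    also have "\<dots> \<le> ennreal 2 * X" unfolding X_def by (rule carleson[OF Q])
    also have "\<dots> \<le> ennreal 2 * (ennreal A * emeasure wM Q)" by (intro mult_left_mono X) simp
    finally have "ennreal (real K * measure wM (layer K Q)) \<le> ennreal (2 * (A * measure wM Q))"
      using A(2) by (simp add: W.emeasure_eq_measure ennreal_mult)
    then have "real K * measure wM (layer K Q) \<le> 2 * A * measure wM Q"
      using A(2) by (subst (asm) ennreal_le_iff) auto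
    also have "\<dots> \<le> real K / 2 * measure wM Q"
      using K(1) by (intro mult_right_mono) (auto simp: A_def)
    finally have "measure wM (layer K Q) \<le> 1/2 * measure wM Q" using K(2) by simp
    then show ?thesis
      unfolding W.emeasure_eq_measure by (subst ennreal_mult''[symmetric]) (auto intro: ennreal_leI)
  qed
qed

text \<open>Lebesgue measure halves with every generation, so for almost every point the chain of
  stopped rectangles around it ends.\<close>

lemma ae_leaves: "AE x in lebesgue. x \<in> R \<longrightarrow> (\<exists>N. x \<notin> layer N R)"
proof -
  have Rr: "R \<in> rectangles" using root rect by blast
  have le: "emeasure lebesgue (layer n R) \<le> ennreal ((1/2) ^ n * measure lebesgue R)" for n
  proof -
    have "emeasure lebesgue (layer (n * 1) R) \<le> ennreal (1/2) ^ n * emeasure lebesgue R"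
      using node_sets sparse root by (intro emeasure_layer_power) (auto simp: layer_def)
    then show ?thesis unfolding rectangles_emeasure[OF Rr]
      by (subst ennreal_mult'') (auto simp: ennreal_power[symmetric])
  qed
  have sets: "(\<Inter>N. layer N R) \<in> sets lebesgue" using layer_sets[OF root] by auto
  have "emeasure lebesgue (\<Inter>N. layer N R) \<le> ennreal ((1/2) ^ n * measure lebesgue R)" for n
    by (rule order_trans[OF emeasure_mono le]) (use layer_sets[OF root] in auto)
  moreover have "(\<lambda>n. ennreal ((1/2) ^ n * measure lebesgue R)) \<longlonglongrightarrow> ennreal (0 * measure lebesgue R)"
    by (intro tendsto_intros LIMSEQ_realpow_zero) auto
  ultimately have "emeasure lebesgue (\<Inter>N. layer N R) \<le> ennreal (0 * measure lebesgue R)"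
    by (intro LIMSEQ_le_const[where X = "\<lambda>n. ennreal ((1/2) ^ n * measure lebesgue R)"]) auto
  then have "(\<Inter>N. layer N R) \<in> null_sets lebesgue" using sets by (auto simp: null_sets_def)
  then have "AE x in lebesgue. x \<notin> (\<Inter>N. layer N R)" by (rule AE_not_in)
  then show ?thesis by (rule AE_mp) auto
qed

end

section \<open>One stopping step\<close>

definition osc_le :: "nat \<Rightarrow> (real ^ 'n \<Rightarrow> real) \<Rightarrow> ((real ^ 'n) set \<Rightarrow> real) \<Rightarrow> bool" where
  "osc_le m f a \<longleftrightarrow> (\<forall>R\<in>rectangles. avg R (\<lambda>x. \<bar>f x - proj m R f x\<bar>) \<le> a R)"

text \<open>A Calderon-Zygmund decomposition of |f - P_Q f| at height \<open>2 * a Q\<close>, twice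
  the bound on its average: hence the half. The averages on members of \<open>V\<close> are at most
  2^n times this height, whence the exponent \<open>Suc CARD('n)\<close>.\<close>

lemma stopping_children:
  fixes f :: "real ^ 'n \<Rightarrow> real"
  assumes C: "\<And>Q g x. Q \<in> rectangles \<Longrightarrow> set_integrable lebesgue Q g \<Longrightarrow> x \<in> (Q :: (real ^ 'n) set) \<Longrightarrow>
      \<bar>proj m Q g x\<bar> \<le> C * avg Q (\<lambda>y. \<bar>g y\<bar>)" "0 < C"
    and f: "locally_integrable f" and osc: "osc_le m f a" and apos: "\<And>Q. Q \<in> rectangles \<Longrightarrow> 0 < a Q"
    and Q: "Q \<in> rectangles"
  shows "\<exists>V. V \<subseteq> dyadic_subrectangles Q \<and> disjoint V
    \<and> emeasure lebesgue (\<Union>V) \<le> ennreal (1/2) * emeasure lebesgue Q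
    \<and> (AE x in lebesgue. x \<in> Q - \<Union>V \<longrightarrow> \<bar>f x - proj m Q f x\<bar> \<le> 2 * a Q)
    \<and> (\<forall>Q'\<in>V. \<forall>x\<in>Q'. \<bar>f x - proj m Q f x\<bar>
          \<le> C * 2 ^ Suc CARD('n) * a Q + \<bar>f x - proj m Q' f x\<bar>)"
proof -
  have fi: "set_integrable lebesgue P f" if "P \<in> rectangles" for P
    by (rule locally_integrable_rectangle[OF f that])
  define p where "p = proj m Q f"
  have p: "p \<in> polys m" unfolding p_def by (rule proj_in_polys[OF Q])
  have pi: "set_integrable lebesgue P p" if "P \<in> rectangles" for P
    by (rule set_integrable_continuous_rectangle[OF that polys_continuous[OF p]])
  have gi: "set_integrable lebesgue P (\<lambda>x. f x - p x)" if "P \<in> rectangles" for P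
    using fi[OF that] pi[OF that] by simp
  define h where "h x = \<bar>f x - p x\<bar>" for x
  have hi: "set_integrable lebesgue P h" if "P \<in> rectangles" for P
    unfolding h_def by (rule set_integrable_abs[OF gi[OF that]])
  have aQ: "0 < a Q" by (rule apos[OF Q])
  have avgQ: "avg Q h \<le> a Q" using osc Q by (simp add: osc_le_def h_def[abs_def] p_def)
  then have "avg Q h < 2 * a Q" using aQ by simp
  from calderon_zygmund[OF Q hi[OF Q] _ this] obtain V where
    V: "V \<subseteq> dyadic_subrectangles Q" "disjoint V"
    "\<And>P. P \<in> V \<Longrightarrow> avg P h \<le> 2 ^ CARD('n) * (2 * a Q)"
    "ennreal (2 * a Q) * emeasure lebesgue (\<Union>V) \<le> ennreal (avg Q h * measure lebesgue Q)"
    "AE x in lebesgue. x \<in> Q - \<Union>V \<longrightarrow> h x \<le> 2 * a Q"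
    by (auto simp: h_def)
  have "emeasure lebesgue (\<Union>V) \<le> ennreal (1/2) * emeasure lebesgue Q"
  proof -
    have "emeasure lebesgue (\<Union>V) = ennreal (1 / (2 * a Q)) * (ennreal (2 * a Q) * emeasure lebesgue (\<Union>V))"
      using aQ by (simp add: mult.assoc[symmetric] ennreal_mult'[symmetric] del: ennreal_mult')
    also have "\<dots> \<le> ennreal (1 / (2 * a Q)) * ennreal (avg Q h * measure lebesgue Q)"
      by (intro mult_left_mono V(4)) simp
    also have "\<dots> \<le> ennreal (1 / (2 * a Q)) * ennreal (a Q * measure lebesgue Q)"
      by (intro mult_left_mono ennreal_leI mult_right_mono avgQ) auto
    also have "\<dots> = ennreal (1 / (2 * a Q) * (a Q * measure lebesgue Q))"
      using aQ by (intro ennreal_mult[symmetric]) auto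
    also have "1 / (2 * a Q) * (a Q * measure lebesgue Q) = 1/2 * measure lebesgue Q"
      using aQ by simp
    also have "ennreal (1/2 * measure lebesgue Q) = ennreal (1/2) * emeasure lebesgue Q"
      unfolding rectangles_emeasure[OF Q] by (rule ennreal_mult) auto
    finally show ?thesis .
  qed
  moreover have "\<bar>f x - p x\<bar> \<le> C * 2 ^ Suc CARD('n) * a Q + \<bar>f x - proj m P f x\<bar>"
    if P: "P \<in> V" and x: "x \<in> P" for P x
  proof -
    have Pr: "P \<in> rectangles" using V(1) P Q dyadic_subrectangles_rectangles by blast
    \<comment> \<open>\<open>proj m P\<close> fixes the polynomial \<open>p\<close>, so the
      difference of the projections is the projection of \<open>f - p\<close>, which the average of
      \<open>h\<close> over \<open>P\<close> controls.\<close>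
    have "proj m P f x - p x = proj m P (\<lambda>x. f x - p x) x"
      unfolding proj_diff[OF Pr fi[OF Pr] pi[OF Pr]] proj_poly[OF Pr p] ..
    also have "\<bar>\<dots>\<bar> \<le> C * avg P h"
      unfolding h_def by (rule C(1)[OF Pr gi[OF Pr] x])
    also have "\<dots> \<le> C * (2 ^ CARD('n) * (2 * a Q))" using C(2) V(3)[OF P] by simp
    finally show ?thesis by (simp add: mult.assoc)
  qed
  ultimately show ?thesis using V(1,2,5) unfolding p_def[symmetric] h_def by blast
qed

section \<open>The weak-type estimate\<close>

lemma epowr_le:
  assumes "x \<le> ennreal Y" "0 < s" shows "epowr x s \<le> ennreal (Y powr s)"
proof -
  have x: "x \<noteq> top" using assms(1) by (auto simp: top_unique)
  have "enn2real x \<le> max 0 Y"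
    using enn2real_mono[OF assms(1)] by (cases "0 \<le> Y") (auto simp: ennreal_neg)
  then have "enn2real x powr s \<le> max 0 Y powr s" using assms(2) by (intro powr_mono2) auto
  also have "\<dots> \<le> Y powr s" using assms(2) by (cases "0 \<le> Y") (auto simp: max_def)
  finally show ?thesis using x by (simp add: epowr_def ennreal_leI)
qed

lemma epowr_ennreal: "0 \<le> x \<Longrightarrow> epowr (ennreal x) s = ennreal (x powr s)"
  by (simp add: epowr_def)

lemma wmeas_finite:
  assumes "weight w" "R \<in> rectangles" shows "wmeas w R < top"
proof -
  have "set_integrable lebesgue R w"
    using assms locally_integrable_rectangle by (auto simp: weight_def)
  then have "wmeas w R = ennreal (avg R w * measure lebesgue R)"
    unfolding wmeas_def using assms by (intro set_nn_integral_eq_avg) (auto simp: weight_def)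
  then show ?thesis by simp
qed

text \<open>On \<open>R\<close> the maximal function is at least the average of \<open>w\<close>
  over \<open>R\<close>. The bound absorbs the additive constants from rounding \<open>K\<close>
  into a multiple of [w].\<close>

lemma A_infty_const_ge_1:
  assumes w: "weight w" and R: "R \<in> rectangles" and pos: "0 < wmeas w R"
  shows "1 \<le> A_infty_const w"
proof -
  define X where "X = (\<integral>\<^sup>+x\<in>R. strong_maximal (\<lambda>y. w y * indicator R y) x \<partial>lebesgue)"
  have m: "emeasure lebesgue R \<noteq> 0" "emeasure lebesgue R < top"
    using rectangles_measure_pos[OF R] rectangles_emeasure[OF R] by auto
  have "wmeas w R = wmeas w R / emeasure lebesgue R * emeasure lebesgue R"
    using m by (simp add: ennreal_divide_times ennreal_divide_self)
  also have "\<dots> = (\<integral>\<^sup>+x. wmeas w R / emeasure lebesgue R * indicator R x \<partial>lebesgue)"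
    using rectangles_sets[OF R] by (simp add: nn_integral_cmult_indicator)
  also have "\<dots> \<le> X" unfolding X_def
  proof (rule nn_integral_mono)
    fix x
    have "(\<integral>\<^sup>+y\<in>R. ennreal \<bar>w y * indicator R y\<bar> \<partial>lebesgue) = wmeas w R"
      unfolding wmeas_def using w
      by (intro nn_integral_cong) (auto simp: weight_def split: split_indicator)
    then have "wmeas w R / emeasure lebesgue R \<le> strong_maximal (\<lambda>y. w y * indicator R y) x" if "x \<in> R"
      unfolding strong_maximal_def using R that by (intro SUP_upper2[of R]) auto
    then show "wmeas w R / emeasure lebesgue R * indicator R x
        \<le> strong_maximal (\<lambda>y. w y * indicator R y) x * indicator R x"
      by (auto split: split_indicator)
  qed
  finally have "wmeas w R / wmeas w R \<le> X / wmeas w R" by (rule divide_right_mono_ennreal)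
  also have "\<dots> \<le> A_infty_const w" unfolding A_infty_const_def X_def using R by (intro SUP_upper)
  finally show ?thesis using pos wmeas_finite[OF w R] by (simp add: ennreal_divide_self)
qed

text \<open>Tests the condition on the family {R}. It excludes \<open>D_norm = 0\<close>, which
  would annihilate an infinite [w] in the final product.\<close>

lemma D_bound_ge_1:
  assumes w: "weight w" and R: "R \<in> rectangles" and pos: "0 < wmeas w R"
    and p: "0 < p" and a: "0 < a R" and c: "D_bound p w a c"
  shows "1 \<le> c"
proof -
  have "epowr (\<Sum>\<^sub>\<infinity>Q\<in>{R}. ennreal (a Q powr p) * (wmeas w Q / wmeas w R)) (1 / p) \<le> c * ennreal (a R)"
    by (rule c[unfolded D_bound_def, rule_format, OF R])
       (auto simp: disjoint_def dyadic_subrectangles.self)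
  then have "ennreal (a R) \<le> c * ennreal (a R)"
    using pos wmeas_finite[OF w R] p a by (simp add: ennreal_divide_self epowr_ennreal powr_powr)
  then have "ennreal (a R) / ennreal (a R) \<le> c * ennreal (a R) / ennreal (a R)"
    by (rule divide_right_mono_ennreal)
  then show ?thesis using a by (simp add: ennreal_divide_self ennreal_times_divide[symmetric])
qed

text \<open>The two entries of \<open>A\<close> are the two losses on the way down: 2 at the last
  stopped rectangle containing the point, and \<open>C * 2 ^ Suc CARD('n)\<close> for each passage
  to a child. So |f - P_R f| is at most \<open>A\<close> times the sum along the path, and its level
  set at \<open>A * t\<close> lies in \<open>superlevel t\<close> up to a null set.\<close>

lemma level_set_bound:
  fixes f w :: "real ^ 'n \<Rightarrow> real"
  assumes C: "\<And>Q g x. Q \<in> rectangles \<Longrightarrow> set_integrable lebesgue Q g \<Longrightarrow> x \<in> (Q :: (real ^ 'n) set) \<Longrightarrow>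
      \<bar>proj m Q g x\<bar> \<le> C * avg Q (\<lambda>y. \<bar>g y\<bar>)" "0 < C"
    and f: "locally_integrable f" and osc: "osc_le m f a" and apos: "\<And>Q. Q \<in> rectangles \<Longrightarrow> 0 < a Q"
    and R: "R \<in> rectangles" and w: "weight w" and pos: "0 < wmeas w R"
    and fin: "A_infty_const w < top" and p: "0 < p" and c: "D_bound p w a (ennreal c)" "0 \<le> c"
    and t: "0 < t"
    and A: "A = max 2 (C * 2 ^ Suc CARD('n))"
  shows "wmeas w {x \<in> R. \<bar>f x - proj m R f x\<bar> > A * t}
    \<le> ennreal (8 * (16 * (c * a R) * p * enn2real (A_infty_const w) / t) powr p) * wmeas w R"
proof -
  define D where "D = dyadic_subrectangles R"
  have RD: "R \<in> D" by (simp add: D_def dyadic_subrectangles.self)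
  have D: "Q \<in> rectangles" "Q \<subseteq> R" "dyadic_subrectangles Q \<subseteq> D" if "Q \<in> D" for Q
    using that R dyadic_subrectangles_rectangles dyadic_subrectangles_subset dyadic_subrectangles_trans
    unfolding D_def by blast+
  define good where "good Q V \<longleftrightarrow> V \<subseteq> dyadic_subrectangles Q \<and> disjoint V
    \<and> emeasure lebesgue (\<Union>V) \<le> ennreal (1/2) * emeasure lebesgue Q
    \<and> (AE x in lebesgue. x \<in> Q - \<Union>V \<longrightarrow> \<bar>f x - proj m Q f x\<bar> \<le> 2 * a Q)
    \<and> (\<forall>Q'\<in>V. \<forall>x\<in>Q'. \<bar>f x - proj m Q f x\<bar>
          \<le> C * 2 ^ Suc CARD('n) * a Q + \<bar>f x - proj m Q' f x\<bar>)" for Q V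
  \<comment> \<open>Defined for all dyadic subrectangles at once; the recursion of the stopping
    process is left to \<open>gen\<close>.\<close>
  define ch where "ch Q = (SOME V. good Q V)" for Q
  have ch: "good Q (ch Q)" if "Q \<in> D" for Q
  proof -
    have "\<exists>V. good Q V" unfolding good_def
      by (rule stopping_children[OF C f osc apos D(1)[OF that]])
    then show ?thesis unfolding ch_def by (rule someI_ex)
  qed
  have wi: "set_integrable lebesgue R w"
    using w R locally_integrable_rectangle by (auto simp: weight_def)
  interpret sparse_tree D ch R w
  proof
    show "countable D" unfolding D_def by (rule countable_dyadic_subrectangles)
    fix Q assume Q: "Q \<in> D"
    show "ch Q \<subseteq> D" "disjoint (ch Q)" "emeasure lebesgue (\<Union>(ch Q)) \<le> ennreal (1/2) * emeasure lebesgue Q"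
      using ch[OF Q] D(3)[OF Q] unfolding good_def by blast+
    show "Q' \<subseteq> Q" if "Q' \<in> ch Q" for Q'
      using ch[OF Q] that dyadic_subrectangles_subset unfolding good_def by blast
  qed (use RD D wi w in \<open>auto simp: weight_def\<close>)
  interpret weighted_tree D ch wM R a
  proof (rule weighted_tree.intro[OF set_tree_axioms], rule weighted_tree_axioms.intro)
    show "D \<subseteq> sets wM" using node_sets by (auto simp: sets_wM)
    show "0 < a Q" if "Q \<in> D" for Q by (rule apos[OF D(1)[OF that]])
  qed (rule finite_wM RD)+
  interpret W: finite_measure wM by (rule finite_wM)
  have wQ: "wmeas w Q = ennreal (measure wM Q)" if "Q \<in> D" for Q
    using emeasure_wM[of Q] node_sets[OF that] sub[OF that] by (simp add: W.emeasure_eq_measure)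
  have mR: "0 < measure wM R" using pos wQ[OF RD] by (simp add: ennreal_less_zero_iff)
  define A' where "A' = enn2real (A_infty_const w)"
  have A'1: "1 \<le> A'"
  proof -
    have "enn2real 1 \<le> A'" unfolding A'_def
      using A_infty_const_ge_1[OF w R pos] fin by (intro enn2real_mono)
    then show ?thesis by simp
  qed
  \<comment> \<open>4 [w] generations suffice to halve the weight. Rounding up gives
    \<open>3 * K + 1 \<le> 12 * A' + 4\<close>, and \<open>1 \<le> A'\<close> turns this into
    \<open>16 * A'\<close>.\<close>
  define K where "K = nat \<lceil>4 * A'\<rceil>"
  have K: "4 * A' \<le> real K" "0 < K" "3 * real K + 1 \<le> 16 * A'"
    using A'1 unfolding K_def by linarith+
  \<comment> \<open>The condition D_p in the real form of \<open>superlevel_bound\<close>, with the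
    p-th root and the division by w(R) undone and \<open>B = c * a R\<close>.\<close>
  have DP: "(\<Sum>Q\<in>F. a Q powr p * measure wM Q) \<le> (c * a R) powr p * measure wM R"
    if F: "finite F" "F \<subseteq> D" "disjoint F" for F
  proof -
    define s where "s = (\<Sum>Q\<in>F. a Q powr p * (measure wM Q / measure wM R))"
    have s0: "0 \<le> s" unfolding s_def by (intro sum_nonneg) auto
    have "epowr (\<Sum>\<^sub>\<infinity>Q\<in>F. ennreal (a Q powr p) * (wmeas w Q / wmeas w R)) (1 / p) \<le> ennreal c * ennreal (a R)"
      using c(1) R F unfolding D_bound_def D_def by blast
    also have "(\<Sum>\<^sub>\<infinity>Q\<in>F. ennreal (a Q powr p) * (wmeas w Q / wmeas w R))
      = (\<Sum>Q\<in>F. ennreal (a Q powr p) * (wmeas w Q / wmeas w R))" using F(1) by simp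
    also have "\<dots> = (\<Sum>Q\<in>F. ennreal (a Q powr p * (measure wM Q / measure wM R)))"
    proof (rule sum.cong)
      fix Q assume "Q \<in> F"
      then have "Q \<in> D" using F(2) by blast
      then show "ennreal (a Q powr p) * (wmeas w Q / wmeas w R)
        = ennreal (a Q powr p * (measure wM Q / measure wM R))"
        using mR unfolding wQ[OF RD] by (simp add: wQ divide_ennreal ennreal_mult'[symmetric])
    qed simp
    also have "\<dots> = ennreal s" unfolding s_def by (rule sum_ennreal) auto
    finally have "ennreal (s powr (1 / p)) \<le> ennreal (c * a R)"
      using c(2) apos[OF R] s0 by (simp add: epowr_ennreal ennreal_mult)
    then have "s powr (1 / p) \<le> c * a R"
      using c(2) apos[OF R] by (subst (asm) ennreal_le_iff) auto
    then have "(s powr (1 / p)) powr p \<le> (c * a R) powr p" using p by (intro powr_mono2) auto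
    then have "s \<le> (c * a R) powr p" using p s0 by (simp add: powr_powr)
    moreover have "s = (\<Sum>Q\<in>F. a Q powr p * measure wM Q) / measure wM R"
      by (simp add: s_def sum_divide_distrib)
    ultimately show ?thesis using mR by (simp add: field_simps)
  qed
  have half: "emeasure wM (layer K Q) \<le> ennreal (1/2) * emeasure wM Q" if "Q \<in> D" for Q
    using layer_half[OF that fin] K by (simp add: A'_def)
  have "measure wM (superlevel t) \<le> 8 * ((c * a R) * p * (3 * real K + 1) / t) powr p * measure wM R"
    using c(2) apos[OF R] by (intro superlevel_bound[OF p _ DP half t]) auto
  also have "\<dots> \<le> 8 * (16 * (c * a R) * p * A' / t) powr p * measure wM R"
  proof -
    have "(c * a R) * p * (3 * real K + 1) \<le> (c * a R) * p * (16 * A')"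
      using K(3) c(2) apos[OF R] p by (intro mult_left_mono) auto
    then have "(c * a R) * p * (3 * real K + 1) / t \<le> 16 * (c * a R) * p * A' / t"
      using t by (intro divide_right_mono) (auto simp: algebra_simps)
    then show ?thesis
      using p t c(2) apos[OF R] by (intro mult_right_mono mult_left_mono powr_mono2) auto
  qed
  finally have sup: "measure wM (superlevel t) \<le> 8 * (16 * (c * a R) * p * A' / t) powr p * measure wM R" .
  define g where "g x = f x - proj m R f x" for x
  define S where "S = {x \<in> R. \<bar>g x\<bar> > A * t}"
  have gi: "set_integrable lebesgue R g"
    using locally_integrable_rectangle[OF f R]
      set_integrable_continuous_rectangle[OF R polys_continuous[OF proj_in_polys[OF R]]]
    unfolding g_def by simp
  have "S = R \<inter> {x \<in> space lebesgue. A * t < \<bar>indicator R x *\<^sub>R g x\<bar>}" by (auto simp: S_def)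
  also have "\<dots> \<in> sets lebesgue"
    using gi rectangles_sets[OF R] unfolding set_integrable_def by measurable
  finally have S: "S \<in> sets lebesgue" .
  \<comment> \<open>The exceptional null sets of the countably many nodes are united before any path
    is followed.\<close>
  have "AE x in lebesgue. \<forall>Q\<in>D. x \<in> Q - \<Union>(ch Q) \<longrightarrow> \<bar>f x - proj m Q f x\<bar> \<le> 2 * a Q"
    using ch countable_nodes by (subst AE_ball_countable) (auto simp: good_def)
  then have ae: "AE x in lebesgue. x \<in> S \<longrightarrow> x \<in> superlevel t"
    using ae_leaves
  proof eventually_elim
    fix x assume leaf: "\<forall>Q\<in>D. x \<in> Q - \<Union>(ch Q) \<longrightarrow> \<bar>f x - proj m Q f x\<bar> \<le> 2 * a Q"
      and ex: "x \<in> R \<longrightarrow> (\<exists>N. x \<notin> layer N R)"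
    show "x \<in> S \<longrightarrow> x \<in> superlevel t"
    proof
      assume xS: "x \<in> S"
      then have xR: "x \<in> R" by (simp add: S_def)
      have A2: "2 \<le> A" "C * 2 ^ Suc CARD('n) \<le> A" using A by auto
      \<comment> \<open>Telescoping along the path: the sum stops before generation
        \<open>k\<close>, whose node carries the remaining oscillation.\<close>
      have step: "\<bar>g x\<bar> \<le> A * (\<Sum>j<k. value_at j x) + \<bar>f x - proj m Q f x\<bar>"
        if "Q \<in> gen ch k R" "x \<in> Q" for k Q
        using that
      proof (induction k arbitrary: Q)
        case 0 then show ?case by (simp add: g_def)
      next
        case (Suc k)
        then obtain P where P: "P \<in> gen ch k R" "Q \<in> ch P" by auto
        have PD: "P \<in> D" using gen_nodes[OF RD] P by blast
        have xP: "x \<in> P" using children_subset[OF PD P(2)] Suc.prems by blast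
        have "\<bar>f x - proj m P f x\<bar> \<le> C * 2 ^ Suc CARD('n) * a P + \<bar>f x - proj m Q f x\<bar>"
          using ch[OF PD] P(2) Suc.prems(2) unfolding good_def by blast
        also have "C * 2 ^ Suc CARD('n) * a P \<le> A * a P"
          using A2(2) a_pos[OF PD] by (intro mult_right_mono) auto
        also have "a P = value_at k x" using value_at_eq[OF P(1) xP] by simp
        finally show ?case using Suc.IH[OF P(1) xP] by (simp add: distrib_left)
      qed
      \<comment> \<open>The first generation that misses \<open>x\<close>. It is not generation 0,
        which is \<open>R\<close>, so the one before it holds the last node around
        \<open>x\<close>.\<close>
      define N where "N = (LEAST N. x \<notin> layer N R)"
      have N: "x \<notin> layer N R" unfolding N_def by (rule LeastI_ex) (use ex xR in blast)
      then obtain k where k: "N = Suc k" using xR by (cases N) auto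
      then have "x \<in> layer k R" using not_less_Least[of k "\<lambda>N. x \<notin> layer N R"] by (simp add: N_def)
      then obtain Q where Q: "Q \<in> gen ch k R" "x \<in> Q" by (auto simp: layer_def)
      have QD: "Q \<in> D" using gen_nodes[OF RD] Q by blast
      have "x \<notin> \<Union>(ch Q)" using N Q(1) unfolding k by (auto simp: layer_def)
      then have "\<bar>f x - proj m Q f x\<bar> \<le> 2 * a Q" using leaf QD Q(2) by blast
      also have "\<dots> \<le> A * a Q" using A2(1) a_pos[OF QD] by (intro mult_right_mono) auto
      also have "a Q = value_at k x" using value_at_eq[OF Q] by simp
      finally have "\<bar>g x\<bar> \<le> A * path_sum k x"
        using step[OF Q] by (simp add: path_sum_def distrib_left lessThan_Suc_atMost[symmetric])
      moreover have "A * t < \<bar>g x\<bar>" using xS by (simp add: S_def)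
      ultimately have "A * t < A * path_sum k x" by simp
      then show "x \<in> superlevel t" using A2(1) by (auto simp: superlevel_def)
    qed
  qed
  have "wmeas w S = emeasure wM S" using S by (intro emeasure_wM[symmetric]) (auto simp: S_def)
  \<comment> \<open>\<open>wM\<close> has a density with respect to Lebesgue measure, so an
    inclusion up to a Lebesgue null set suffices.\<close>
  also have "\<dots> \<le> emeasure wM (superlevel t)"
  proof (rule emeasure_mono_AE)
    show "AE x in wM. x \<in> S \<longrightarrow> x \<in> superlevel t"
      unfolding wM_def using ae w_int by (subst AE_density) (auto simp: set_integrable_def)
    show "superlevel t \<in> sets wM" unfolding superlevel_eq[OF t] by (rule sets_first)
  qed
  also have "\<dots> \<le> ennreal (8 * (16 * (c * a R) * p * A' / t) powr p * measure wM R)"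
    unfolding W.emeasure_eq_measure using sup by (rule ennreal_leI)
  also have "\<dots> = ennreal (8 * (16 * (c * a R) * p * A' / t) powr p) * wmeas w R"
    unfolding wQ[OF RD] by (rule ennreal_mult) auto
  finally show ?thesis unfolding S_def g_def A'_def .
qed

text \<open>Takes p-th roots in \<open>level_set_bound\<close> at the level
  \<open>s = A * t\<close>. The factor 8 becomes \<open>8 powr (1 / p)\<close>, at most
  \<open>8 powr (1 / p0)\<close>; the rest is linear in \<open>p\<close> because \<open>p\<close>
  stood inside the p-th power.\<close>

lemma weak_norm_bound:
  fixes f w :: "real ^ 'n \<Rightarrow> real"
  assumes C: "\<And>Q g x. Q \<in> rectangles \<Longrightarrow> set_integrable lebesgue Q g \<Longrightarrow> x \<in> (Q :: (real ^ 'n) set) \<Longrightarrow>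
      \<bar>proj m Q g x\<bar> \<le> C * avg Q (\<lambda>y. \<bar>g y\<bar>)" "0 < C"
    and f: "locally_integrable f" and osc: "osc_le m f a" and apos: "\<And>Q. Q \<in> rectangles \<Longrightarrow> 0 < a Q"
    and R: "R \<in> rectangles" and w: "weight w" and pos: "0 < wmeas w R"
    and fin: "A_infty_const w < top" and p: "0 < p0" "p0 \<le> p"
    and c: "D_bound p w a (ennreal c)" "0 \<le> c"
    and A: "A = max 2 (C * 2 ^ Suc CARD('n))"
  shows "weak_norm p R w (\<lambda>x. f x - proj m R f x)
    \<le> ennreal (16 * A * 8 powr (1 / p0) * p) * A_infty_const w * ennreal c * ennreal (a R)"
  unfolding weak_norm_def
proof (rule SUP_least)
  fix s :: real assume "s \<in> {0<..}"
  then have s: "0 < s" by simp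
  have A0: "0 < A" using A by simp
  define A' where "A' = enn2real (A_infty_const w)"
  have A': "A_infty_const w = ennreal A'" "0 \<le> A'" using fin by (auto simp: A'_def)
  define Y where "Y = 16 * (c * a R) * p * A'"
  have Y: "0 \<le> Y" unfolding Y_def using c(2) apos[OF R] p A' by (intro mult_nonneg_nonneg) auto
  define t where "t = s / A"
  have t: "0 < t" "s = A * t" using s A0 by (auto simp: t_def)
  define S where "S = {x \<in> R. \<bar>f x - proj m R f x\<bar> > s}"
  have "wmeas w S \<le> ennreal (8 * (Y / t) powr p) * wmeas w R"
    unfolding S_def t(2) Y_def A'_def
    by (rule level_set_bound[OF C f osc apos R w pos fin _ c t(1) A]) (use p in auto)
  then have "wmeas w S / wmeas w R \<le> ennreal (8 * (Y / t) powr p) * wmeas w R / wmeas w R"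
    by (rule divide_right_mono_ennreal)
  also have "\<dots> = ennreal (8 * (Y / t) powr p)"
    using pos wmeas_finite[OF w R] by (simp add: ennreal_times_divide[symmetric] ennreal_divide_self)
  finally have "epowr (wmeas w S / wmeas w R) (1 / p) \<le> ennreal ((8 * (Y / t) powr p) powr (1 / p))"
    using p by (intro epowr_le) auto
  then have "ennreal s * epowr (wmeas w S / wmeas w R) (1 / p)
      \<le> ennreal s * ennreal ((8 * (Y / t) powr p) powr (1 / p))"
    by (rule mult_left_mono) simp
  also have "\<dots> = ennreal (s * (8 * (Y / t) powr p) powr (1 / p))"
    using s by (intro ennreal_mult[symmetric]) auto
  also have "(8 * (Y / t) powr p) powr (1 / p) = 8 powr (1 / p) * (Y / t)"
    using Y t p by (simp add: powr_mult powr_powr)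
  also have "s * (8 powr (1 / p) * (Y / t)) = A * 8 powr (1 / p) * Y" using t by simp
  also have "\<dots> \<le> A * 8 powr (1 / p0) * Y"
    using A0 Y p by (intro mult_right_mono mult_left_mono powr_mono divide_left_mono) auto
  also have "A * 8 powr (1 / p0) * Y = (16 * A * 8 powr (1 / p0) * p) * A' * c * a R"
    by (simp add: Y_def)
  also have "ennreal \<dots> = ennreal (16 * A * 8 powr (1 / p0) * p) * ennreal A' * ennreal c * ennreal (a R)"
    using A0 p A' c(2) apos[OF R] by (simp add: ennreal_mult)
  finally show "ennreal s * epowr (wmeas w {x \<in> R. s < \<bar>f x - proj m R f x\<bar>} / wmeas w R) (1 / p)
    \<le> ennreal (16 * A * 8 powr (1 / p0) * p) * A_infty_const w * ennreal c * ennreal (a R)"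
    unfolding S_def A'(1) by (simp add: ennreal_leI)
qed

text \<open>Beyond \<open>weak_norm_bound\<close> there remain the degenerate values in
  \<open>ennreal\<close> and the passage from a single bound \<open>c\<close> to the infimum
  \<open>D_norm\<close>, which is not assumed to be attained.\<close>

theorem theorem2p3:
  fixes m :: nat and p0 :: real
  assumes "0 < p0"
  shows "\<exists>c>0. \<forall>p\<ge>p0. \<forall>(w :: real ^ 'n \<Rightarrow> real) (a :: (real ^ 'n) set \<Rightarrow> real) (f :: real ^ 'n \<Rightarrow> real).
    w \<in> A_infty \<longrightarrow>
    (\<forall>R\<in>rectangles. 0 < a R) \<longrightarrow>
    a \<in> D_class p w \<longrightarrow>
    locally_integrable f \<longrightarrow>
    (\<forall>R\<in>rectangles. avg R (\<lambda>x. \<bar>f x - proj m R f x\<bar>) \<le> a R) \<longrightarrow>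
    (\<forall>R\<in>rectangles.
       weak_norm p R w (\<lambda>x. f x - proj m R f x)
         \<le> ennreal (c * p) * A_infty_const w * D_norm p w a * ennreal (a R))"
proof -
  obtain C where C: "0 < C" "\<And>Q g x. Q \<in> rectangles \<Longrightarrow> set_integrable lebesgue Q g \<Longrightarrow>
      x \<in> (Q :: (real ^ 'n) set) \<Longrightarrow> \<bar>proj m Q g x\<bar> \<le> C * avg Q (\<lambda>y. \<bar>g y\<bar>)"
    using proj_sup_le_avg[of m, where ?'n = 'n] by blast
  define A where "A = max 2 (C * 2 ^ Suc CARD('n))"
  define c0 where "c0 = 16 * A * 8 powr (1 / p0)"
  have c0: "0 < c0" by (simp add: c0_def A_def)
  show ?thesis
  proof (intro exI[of _ c0] conjI c0 allI impI ballI)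
    fix p and w f :: "real ^ 'n \<Rightarrow> real" and a and R :: "(real ^ 'n) set"
    assume p: "p0 \<le> p" and wA: "w \<in> A_infty" and apos: "\<forall>R\<in>rectangles. 0 < a R"
      and f: "locally_integrable f"
      and osc: "\<forall>R\<in>rectangles. avg R (\<lambda>x. \<bar>f x - proj m R f x\<bar>) \<le> a R"
      and R: "R \<in> rectangles"
    have p_pos: "0 < p" using p assms by simp
    have w: "weight w" using wA by (auto simp: A_infty_def A_class_def)
    have aR: "0 < a R" using apos R by blast
    show "weak_norm p R w (\<lambda>x. f x - proj m R f x)
      \<le> ennreal (c0 * p) * A_infty_const w * D_norm p w a * ennreal (a R)"
    proof (cases "wmeas w R = 0")
      case True
      \<comment> \<open>The quotients in the weak norm are 0 / 0, which is 0 in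
        \<open>ennreal\<close>.\<close>
      have "wmeas w {x \<in> R. P x} = 0" for P
      proof -
        have "wmeas w {x \<in> R. P x} \<le> wmeas w R" unfolding wmeas_def
          by (intro nn_integral_mono) (auto split: split_indicator)
        then show ?thesis using True by simp
      qed
      then show ?thesis using p_pos by (simp add: weak_norm_def epowr_def)
    next
      case False
      then have pos: "0 < wmeas w R" by (simp add: zero_less_iff_neq_zero)
      have D1: "1 \<le> D_norm p w a" unfolding D_norm_def
        by (rule Inf_greatest) (use D_bound_ge_1[where a = a, OF w R pos p_pos aR] in auto)
      have A1: "1 \<le> A_infty_const w" by (rule A_infty_const_ge_1[OF w R pos])
      \<comment> \<open>Everything on the right except \<open>D_norm\<close>. It is nonzero, and
        finite once [w] is, so dividing by it isolates \<open>c\<close> before the infimum is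
        taken.\<close>
      define Z where "Z = ennreal (c0 * p) * A_infty_const w * ennreal (a R)"
      have Z0: "Z \<noteq> 0" using c0 p_pos aR A1 by (auto simp: Z_def ennreal_eq_0_iff mult_le_0_iff)
      show ?thesis
      proof (cases "A_infty_const w = top")
        case True
        \<comment> \<open>The right-hand side is infinite, all its other factors being
          positive.\<close>
        then show ?thesis using c0 p_pos aR D1
          by (auto simp: ennreal_mult_top ennreal_top_mult ennreal_mult_eq_top_iff top_unique)
      next
        case False
        then have fin: "A_infty_const w < top" by (simp add: less_top)
        have Zt: "Z < top" using fin by (simp add: Z_def ennreal_mult_less_top)
        have "weak_norm p R w (\<lambda>x. f x - proj m R f x) / Z \<le> c" if "D_bound p w a c" for c
        proof (cases "c = top")
          case False
          then obtain c' where c': "c = ennreal c'" "0 \<le> c'" by (cases c) auto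
          have "weak_norm p R w (\<lambda>x. f x - proj m R f x) \<le> ennreal (c0 * p) * A_infty_const w * c * ennreal (a R)"
            using weak_norm_bound[OF C(2,1) f _ _ R w pos fin assms p _ c'(2) A_def, of a] osc apos that c'(1)
            by (simp add: osc_le_def c0_def)
          also have "\<dots> = Z * c" by (simp add: Z_def ac_simps)
          finally have "weak_norm p R w (\<lambda>x. f x - proj m R f x) / Z \<le> Z * c / Z"
            by (rule divide_right_mono_ennreal)
          also have "\<dots> = c" using Z0 Zt
            by (simp add: mult.commute[of Z] ennreal_times_divide[symmetric] ennreal_divide_self)
          finally show ?thesis .
        qed simp
        then have "weak_norm p R w (\<lambda>x. f x - proj m R f x) / Z \<le> D_norm p w a"
          unfolding D_norm_def by (intro Inf_greatest) auto
        then have "weak_norm p R w (\<lambda>x. f x - proj m R f x) / Z * Z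
            \<le> D_norm p w a * Z"
          by (rule mult_right_mono) simp
        also have "weak_norm p R w (\<lambda>x. f x - proj m R f x) / Z * Z = weak_norm p R w (\<lambda>x. f x - proj m R f x)"
          using Z0 Zt by (simp add: ennreal_divide_times ennreal_divide_self)
        also have "D_norm p w a * Z = ennreal (c0 * p) * A_infty_const w * D_norm p w a * ennreal (a R)"
          by (simp add: Z_def ac_simps)
        finally show ?thesis .
      qed
    qed
  qed
qed

end
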